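(* Let $d=2$. There exists a constant $C_*>0$ such that for every $n\in\mathbb{N}$ $$\inf_{\bar{\boldsymbol f}_n}\ \sup_{\boldsymbol f_*\in\mathcal{F}^{\mathrm L}_{\mathrm{INV}}}\ \mathsf{R}^{\ddagger}_{\mathrm{INV}}(\bar{\boldsymbol f}_n,\boldsymbol f_* )\ \ge\ C_*\,n^{-2/(2+d)},$$ where the infimum is over all measurable estimators $\bar{\boldsymbol f}_n$ depending on the sample $\mathcal{D}_n$.
   Context: Let $d=2$ and $I=[-1,1]$. $\mathcal{F}^{\mathrm L}_{\mathrm{INV}}$ is the set of bijections $\boldsymbol f:I^2\to I^2$ that are bi-Lipschitz, i.e. there is some $L\ge 1$ with $L^{-1}\|\boldsymbol x-\boldsymbol x'\|_2\le\|\boldsymbol f(\boldsymbol x)-\boldsymbol f(\boldsymbol x')\|_2\le L\|\boldsymbol x-\boldsymbol x'\|_2$ for all $\boldsymbol x,\boldsymbol x'\in I^2$. Model: $\mathcal{D}_n=\{(\boldsymbol X_i,\boldsymbol Y_i)\}_{i=1}^n\subset I^2\times\mathbb{R}^2$ are i.i.d. with $\boldsymbol Y_i=\boldsymbol f_*(\boldsymbol X_i)+\boldsymbol\varepsilon_i$, $\boldsymbol\varepsilon_i\sim N_2(\boldsymbol 0,\sigma^2\boldsymbol I_2)$ i.i.d., $\sigma^2>0$ fixed, $\boldsymbol f_*\in\mathcal{F}^{\mathrm L}_{\mathrm{INV}}$ the true function. The (fixed) marginal distribution $P_{\boldsymbol X}$ of $\boldsymbol X_i$ has a density that is positive and bounded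 on $I^2$. $\mathbb{E}_n$ is expectation with respect to $\mathcal{D}_n$. An estimator $\bar{\boldsymbol f}_n$ is a measurable function of $\mathcal{D}_n$ with values in (measurable) maps $I^2\to\mathbb{R}^2$. Its quasi-inverse $\bar{\boldsymbol f}_n^{\ddagger}:I^2\to\mathbb{R}^2$ is: $\bar{\boldsymbol f}_n^{\ddagger}(\boldsymbol y)=\boldsymbol x$ if $\boldsymbol x\in I^2$ is the unique point with $\bar{\boldsymbol f}_n(\boldsymbol x)=\boldsymbol y$, and $\bar{\boldsymbol f}_n^{\ddagger}(\boldsymbol y)=\boldsymbol c$ if no unique such point exists, where $\boldsymbol c\in\mathbb{R}^2\setminus I^2$ is a fixed vector. For $\boldsymbol f=(f_1,f_2)$, $\|\boldsymbol f\|_{L^2(P_{\boldsymbol X})}=(\sum_{j=1}^2\int|f_j|^2\,dP_{\boldsymbol X})^{1/2}$. The $L^2$-risk for the inverse is $$\mathsf{R}^{\ddagger}_{\mathrm{INV}}(\bar{\boldsymbol f}_n,\boldsymbol f_* )=\mathbb{E}_n\Big[\|\bar{\boldsymbol f}_n^{\ddagger}-\boldsymbol f_*^{-1}\|_{L^2(P_{\boldsymbol X})}^2\Big].$$ *)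

theory Defs
  imports "HOL-Probability.Probability"
begin

definition square :: "(real^2) set" where
  "square = {x. \<forall>i. x $ i \<in> {-1..1}}"

abbreviation borel_square :: "(real^2) measure" where
  "borel_square \<equiv> restrict_space borel square"

(* Maps from the square are total functions of which only the values on the square matter. *)
definition bilipschitz_bijections :: "(real^2 \<Rightarrow> real^2) set" where
  "bilipschitz_bijections =
     {f. bij_betw f square square \<and>
         (\<exists>L\<ge>1. \<forall>x\<in>square. \<forall>x'\<in>square.
            inverse L * norm (x - x') \<le> norm (f x - f x') \<and>
            norm (f x - f x') \<le> L * norm (x - x'))}"

(* The design distribution lives on the square itself (not on the whole plane), so that
   f needs to be measurable on the square only. *)
definition design_law :: "(real^2 \<Rightarrow> real) \<Rightarrow> (real^2) measure" where
  "design_law p = density (restrict_space lborel square) (\<lambda>x. ennreal (p x))"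

(* Independent N(0, s^2) coordinates, i.e. covariance matrix s^2 times the identity. *)
definition noise_law :: "real \<Rightarrow> (real^2) measure" where
  "noise_law s = density lborel (\<lambda>e. ennreal (\<Prod>i\<in>UNIV. normal_density 0 s (e $ i)))"

definition observation_law ::
    "(real^2) measure \<Rightarrow> real \<Rightarrow> (real^2 \<Rightarrow> real^2) \<Rightarrow> ((real^2) \<times> (real^2)) measure" where
  "observation_law P s f =
     distr (P \<Otimes>\<^sub>M noise_law s) (borel_square \<Otimes>\<^sub>M borel) (\<lambda>(x, e). (x, f x + e))"

definition sample_law ::
    "(real^2) measure \<Rightarrow> real \<Rightarrow> nat \<Rightarrow> (real^2 \<Rightarrow> real^2) \<Rightarrow> (nat \<Rightarrow> (real^2) \<times> (real^2)) measure" where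
  "sample_law P s n f = (\<Pi>\<^sub>M i\<in>{..<n}. observation_law P s f)"

definition sample_space :: "nat \<Rightarrow> (nat \<Rightarrow> (real^2) \<times> (real^2)) measure" where
  "sample_space n = (\<Pi>\<^sub>M i\<in>{..<n}. borel_square \<Otimes>\<^sub>M borel)"

(* Joint measurability in the sample and the argument. *)
definition estimators :: "nat \<Rightarrow> ((nat \<Rightarrow> (real^2) \<times> (real^2)) \<Rightarrow> real^2 \<Rightarrow> real^2) set" where
  "estimators n = {g. (\<lambda>(D, x). g D x) \<in> sample_space n \<Otimes>\<^sub>M borel_square \<rightarrow>\<^sub>M borel}"

definition quasi_inverse :: "real^2 \<Rightarrow> (real^2 \<Rightarrow> real^2) \<Rightarrow> real^2 \<Rightarrow> real^2" where
  "quasi_inverse c g y =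
     (if \<exists>!x. x \<in> square \<and> g x = y then THE x. x \<in> square \<and> g x = y else c)"

definition L2_norm_squared :: "(real^2) measure \<Rightarrow> (real^2 \<Rightarrow> real^2) \<Rightarrow> ennreal" where
  "L2_norm_squared P h = (\<Sum>j\<in>UNIV. \<integral>\<^sup>+ x. ennreal (\<bar>h x $ j\<bar>\<^sup>2) \<partial>P)"

(* The quasi-inverse of a Borel map need not be Borel, but by the measurable projection
   theorem it is measurable for the completed measure, jointly in the sample and the argument.
   The nonnegative integral over a measure agrees with the one over its completion
   (nn_integral_completion), so both integrals below are genuine Lebesgue integrals. *)
definition inverse_risk ::
    "(real^2) measure \<Rightarrow> real \<Rightarrow> real^2 \<Rightarrow> nat \<Rightarrow>
     ((nat \<Rightarrow> (real^2) \<times> (real^2)) \<Rightarrow> real^2 \<Rightarrow> real^2) \<Rightarrow> (real^2 \<Rightarrow> real^2) \<Rightarrow> ennreal" where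
  "inverse_risk P s c n g f =
     (\<integral>\<^sup>+ D. L2_norm_squared P (\<lambda>y. quasi_inverse c (g D) y - inv_into square f y)
        \<partial>sample_law P s n f)"

end

(*
The Lipschitz constant is not bounded over the class, so two hypotheses suffice and even give a
lower bound that does not depend on n. Let f0 stretch the strip {|x_j| <= d} onto the middle half
of the square, and let f1 be f0 after a fixed vertical displacement inside the strip. The inverses
of f0 and f1 differ by a constant on a region R that does not depend on d, whereas f0 and f1 agree
off the strip; for d of order 1/n no design point hits the strip with probability at least 1/2,
and then the sample does not distinguish f0 from f1.

The risk is a lower integral, which is only superadditive on nonmeasurable functions. The risks of
f0 and f1 can be added because {(D, y). some x with x_k <= m has g D x = y} is a projection of a
measurable set, hence measurable up to a null set: rectangles with compact sections generate all
measurable sets by the Souslin operation, and outer measure is a capacity for them.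
*)

theory Submission
  imports Defs
begin

subsection \<open>Measurable projection\<close>

text \<open>The sets where an estimator errs for \<open>f0\<close> and for \<open>f1\<close> need
  not be measurable, so covering the sample space by them does not by itself bound the sum of the
  risks. What is tested instead is whether some preimage has coordinate \<open>k\<close> at most
  \<open>m\<close>. Existence of a preimage is a projection; uniqueness in general is not. Yet
  existence decides enough: if there is no such preimage, the quasi-inverse lies above
  \<open>m\<close> or equals \<open>c\<close>; if there is one, the quasi-inverse is this preimage
  or \<open>c\<close>.

  The direction of the displacement is dictated by \<open>c\<close>. As \<open>c\<close> lies
  outside the square, some coordinate \<open>k\<close> of it exceeds 1 in absolute value, and with
  the displacement along \<open>k\<close> the default value keeps a fixed distance from both
  inverses in that coordinate.\<close>

text \<open>Dependent choice changes one entry per stage, so entry \<open>i\<close> is final from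
  stage \<open>Suc i\<close> on, and the diagonal of the stages is the limit. Locality of
  \<open>E\<close> carries every property over to the limit.\<close>

lemma sequence_by_extension:
  fixes E :: "nat \<Rightarrow> (nat \<Rightarrow> 'a) \<Rightarrow> bool"
  assumes base: "E 0 \<sigma>0"
    and step: "\<And>k \<sigma>. E k \<sigma> \<Longrightarrow> \<exists>a. E (Suc k) (\<sigma>(k := a))"
    and local: "\<And>k \<sigma> \<tau>. (\<And>i. i < k \<Longrightarrow> \<sigma> i = \<tau> i) \<Longrightarrow> E k \<sigma> \<Longrightarrow> E k \<tau>"
  shows "\<exists>\<sigma>. \<forall>k. E k \<sigma>"
proof -
  have "\<exists>f. \<forall>k. E k (f k) \<and> (\<exists>a. f (Suc k) = (f k)(k := a))"
    by (rule dependent_nat_choice) (use base step in blast)+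
  then obtain f where f: "\<And>k. E k (f k)" "\<And>k. \<exists>a. f (Suc k) = (f k)(k := a)"
    by blast
  have agree: "f k i = f (Suc i) i" if "i < k" for i k
    using that
  proof (induction k)
    case (Suc k)
    obtain a where "f (Suc k) = (f k)(k := a)"
      using f(2) by blast
    with Suc show ?case
      by (cases "i = k") auto
  qed simp
  have "E k (\<lambda>i. f (Suc i) i)" for k
    by (rule local[OF _ f(1)]) (rule agree)
  then show ?thesis
    by blast
qed

section \<open>Finite unions of rectangles with one compact side\<close>

text \<open>Finite unions are included because the stages \<open>C j\<close> of the capacitability
  proof are finite unions of finite intersections. Two properties survive: sections over a point are
  compact, and projections to the first factor are measurable.\<close>

inductive_set compact_rects :: "'a measure \<Rightarrow> ('a \<times> 'b::t2_space) set set" for M where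
  rect: "F \<in> sets M \<Longrightarrow> compact K \<Longrightarrow> F \<times> K \<in> compact_rects M"
| Un: "A \<in> compact_rects M \<Longrightarrow> B \<in> compact_rects M \<Longrightarrow> A \<union> B \<in> compact_rects M"

lemma compact_rects_empty: "{} \<in> compact_rects M"
  using compact_rects.rect[of "{}" M "{}"] by simp

lemma compact_rects_Int:
  assumes "A \<in> compact_rects M" "B \<in> compact_rects M"
  shows "A \<inter> B \<in> compact_rects M"
  using assms(1)
proof induction
  case (rect F K)
  show ?case
    using assms(2)
  proof induction
    case (rect F' K')
    then show ?case
      using \<open>F \<in> sets M\<close> \<open>compact K\<close>
      by (auto simp: Times_Int_Times intro!: compact_rects.rect compact_Int)
  next
    case (Un A B)
    then show ?case
      by (auto simp: Int_Un_distrib intro: compact_rects.Un)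
  qed
next
  case (Un A B)
  then show ?case
    by (auto simp: Int_Un_distrib2 intro: compact_rects.Un)
qed

lemma compact_rects_UN:
  "finite S \<Longrightarrow> (\<And>s. s \<in> S \<Longrightarrow> A s \<in> compact_rects M) \<Longrightarrow> (\<Union>s\<in>S. A s) \<in> compact_rects M"
  by (induction S rule: finite_induct) (auto intro: compact_rects_empty compact_rects.Un)

lemma compact_rects_INT:
  "finite S \<Longrightarrow> S \<noteq> {} \<Longrightarrow> (\<And>s. s \<in> S \<Longrightarrow> A s \<in> compact_rects M) \<Longrightarrow> (\<Inter>s\<in>S. A s) \<in> compact_rects M"
  by (induction S rule: finite_ne_induct) (auto intro: compact_rects_Int)

lemma compact_rects_section: "A \<in> compact_rects M \<Longrightarrow> compact (Pair z -` A)"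
proof (induction rule: compact_rects.induct)
  case (rect F K)
  then show ?case
    by (cases "z \<in> F") (auto simp: vimage_def)
qed (auto simp: vimage_Un)

lemma compact_rects_fst: "A \<in> compact_rects M \<Longrightarrow> fst ` A \<in> sets M"
  by (induction rule: compact_rects.induct) (auto simp: image_Un)

text \<open>A Souslin scheme is encoded by sets \<open>P n \<sigma>\<close> depending only on \<open>\<sigma> 0, \<dots>, \<sigma> n\<close>.\<close>

definition souslin_scheme :: "'a measure \<Rightarrow> (nat \<Rightarrow> (nat \<Rightarrow> nat) \<Rightarrow> ('a \<times> 'b::t2_space) set) \<Rightarrow> bool" where
  "souslin_scheme M P \<longleftrightarrow> (\<forall>n \<sigma>. P n \<sigma> \<in> compact_rects M) \<and>
     (\<forall>n \<sigma> \<tau>. (\<forall>i\<le>n. \<sigma> i = \<tau> i) \<longrightarrow> P n \<sigma> = P n \<tau>)"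

definition souslin :: "'a measure \<Rightarrow> ('a \<times> 'b::t2_space) set \<Rightarrow> bool" where
  "souslin M B \<longleftrightarrow> (\<exists>P. souslin_scheme M P \<and> B = {w. \<exists>\<sigma>. \<forall>n. w \<in> P n \<sigma>})"

lemma souslin_schemeD:
  assumes "souslin_scheme M P"
  shows "P n \<sigma> \<in> compact_rects M" "(\<And>i. i \<le> n \<Longrightarrow> \<sigma> i = \<tau> i) \<Longrightarrow> P n \<sigma> = P n \<tau>"
  using assms unfolding souslin_scheme_def by blast+

section \<open>Closure properties of Souslin sets\<close>

lemma souslin_rect: "F \<in> sets M \<Longrightarrow> compact K \<Longrightarrow> souslin M (F \<times> K)"
  unfolding souslin_def by (rule exI[of _ "\<lambda>n \<sigma>. F \<times> K"]) (auto simp: souslin_scheme_def intro: compact_rects.rect)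

text \<open>The index of the union is packed into entry 0 together with the old entry 0. Every level
  of a scheme may depend on entry 0, so the index is known at every level.\<close>

lemma souslin_UN:
  fixes B :: "nat \<Rightarrow> ('a \<times> 'b::t2_space) set"
  assumes "\<And>i. souslin M (B i)"
  shows "souslin M (\<Union>i. B i)"
proof -
  obtain P where P: "\<And>i. souslin_scheme M (P i)" "\<And>i. B i = {w. \<exists>\<sigma>. \<forall>n. w \<in> P i n \<sigma>}"
    using choice[of "\<lambda>i P. souslin_scheme M P \<and> B i = {w. \<exists>\<sigma>. \<forall>n. w \<in> P n \<sigma>}"]
      assms[unfolded souslin_def] by blast
  define R where "R n \<sigma> = P (fst (prod_decode (\<sigma> 0))) n (\<sigma>(0 := snd (prod_decode (\<sigma> 0))))"
    for n and \<sigma> :: "nat \<Rightarrow> nat"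
  have "R n \<sigma> = R n \<tau>" if "\<forall>i\<le>n. \<sigma> i = \<tau> i" for n \<sigma> \<tau>
  proof -
    have "\<sigma> 0 = \<tau> 0"
      using that by simp
    then show ?thesis
      unfolding R_def by (simp only:) (rule souslin_schemeD(2)[OF P(1)], use that in auto)
  qed
  moreover have "(\<Union>i. B i) = {w. \<exists>\<sigma>. \<forall>n. w \<in> R n \<sigma>}"
  proof (intro set_eqI iffI)
    fix w assume "w \<in> (\<Union>i. B i)"
    then obtain i \<sigma> where "\<forall>n. w \<in> P i n \<sigma>"
      using P(2) by blast
    then have "\<forall>n. w \<in> R n (\<sigma>(0 := prod_encode (i, \<sigma> 0)))"
      by (simp add: R_def)
    then show "w \<in> {w. \<exists>\<sigma>. \<forall>n. w \<in> R n \<sigma>}"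
      by blast
  qed (auto simp: R_def P(2))
  moreover have "R n \<sigma> \<in> compact_rects M" for n \<sigma>
    unfolding R_def by (rule souslin_schemeD(1)[OF P(1)])
  ultimately show ?thesis
    unfolding souslin_def souslin_scheme_def by blast
qed

text \<open>One sequence stores a branch for each index \<open>i\<close>, in the positions
  \<open>prod_encode (i, j)\<close>. Level \<open>n\<close> tests a single level of a single scheme,
  the pair being decoded from \<open>n\<close>.\<close>

lemma souslin_INT:
  fixes B :: "nat \<Rightarrow> ('a \<times> 'b::t2_space) set"
  assumes "\<And>i. souslin M (B i)"
  shows "souslin M (\<Inter>i. B i)"
proof -
  obtain P where P: "\<And>i. souslin_scheme M (P i)" "\<And>i. B i = {w. \<exists>\<sigma>. \<forall>n. w \<in> P i n \<sigma>}"
    using choice[of "\<lambda>i P. souslin_scheme M P \<and> B i = {w. \<exists>\<sigma>. \<forall>n. w \<in> P n \<sigma>}"]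
      assms[unfolded souslin_def] by blast
  define R where "R n \<sigma> = P (fst (prod_decode n)) (snd (prod_decode n))
      (\<lambda>j. \<sigma> (prod_encode (fst (prod_decode n), j)))"
    for n and \<sigma> :: "nat \<Rightarrow> nat"
  \<comment> \<open>Level \<open>n\<close> may read only entries up to \<open>n\<close>; this holds
    because the pairing is monotone in its second argument.\<close>
  have mono: "prod_encode (i, j') \<le> prod_encode (i, j)" if "j' \<le> j" for i j j'
    using that monoD[OF incseq_SucI[of triangle], of "i + j'" "i + j"]
    by (simp add: prod_encode_def)
  have "R n \<sigma> = R n \<tau>" if "\<forall>i\<le>n. \<sigma> i = \<tau> i" for n \<sigma> \<tau>
    unfolding R_def
  proof (rule souslin_schemeD(2)[OF P(1)])
    fix j assume "j \<le> snd (prod_decode n)"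
    then have "prod_encode (fst (prod_decode n), j) \<le> n"
      using mono[of j "snd (prod_decode n)" "fst (prod_decode n)"] by simp
    then show "\<sigma> (prod_encode (fst (prod_decode n), j)) = \<tau> (prod_encode (fst (prod_decode n), j))"
      using that by blast
  qed
  moreover have "(\<Inter>i. B i) = {w. \<exists>\<sigma>. \<forall>n. w \<in> R n \<sigma>}"
  proof (intro set_eqI iffI)
    fix w assume "w \<in> (\<Inter>i. B i)"
    then have "\<forall>i. \<exists>\<sigma>. \<forall>n. w \<in> P i n \<sigma>"
      by (simp add: P(2))
    then obtain \<sigma> where "\<And>i n. w \<in> P i n (\<sigma> i)"
      by metis
    then have "\<forall>n. w \<in> R n (\<lambda>k. \<sigma> (fst (prod_decode k)) (snd (prod_decode k)))"
      by (simp add: R_def)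
    then show "w \<in> {w. \<exists>\<sigma>. \<forall>n. w \<in> R n \<sigma>}"
      by blast
  next
    fix w assume "w \<in> {w. \<exists>\<sigma>. \<forall>n. w \<in> R n \<sigma>}"
    then obtain \<sigma> where \<sigma>: "\<And>n. w \<in> R n \<sigma>"
      by blast
    have "w \<in> P i n (\<lambda>j. \<sigma> (prod_encode (i, j)))" for i n
      using \<sigma>[of "prod_encode (i, n)"] by (simp add: R_def)
    then show "w \<in> (\<Inter>i. B i)"
      using P(2) by blast
  qed
  moreover have "R n \<sigma> \<in> compact_rects M" for n \<sigma>
    unfolding R_def by (rule souslin_schemeD(1)[OF P(1)])
  ultimately show ?thesis
    unfolding souslin_def souslin_scheme_def by blast
qed

lemma souslin_Un: "souslin M A \<Longrightarrow> souslin M B \<Longrightarrow> souslin M (A \<union> B)"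
proof -
  assume "souslin M A" "souslin M B"
  then have "souslin M (\<Union>i::nat. if i = 0 then A else B)"
    by (intro souslin_UN) simp
  also have "(\<Union>i::nat. if i = 0 then A else B) = A \<union> B"
    by (auto split: if_splits)
  finally show ?thesis .
qed

lemma souslin_closed_rect:
  fixes K :: "'b::heine_borel set"
  assumes "F \<in> sets M" "closed K"
  shows "souslin M (F \<times> K)"
proof -
  \<comment> \<open>The class \<open>heine_borel\<close> has no distinguished point, so an arbitrary
    centre serves for the exhausting balls.\<close>
  have "K = (\<Union>n::nat. K \<inter> cball undefined (real n))"
    using real_arch_simple by (auto simp: mem_cball)
  then have "F \<times> K = (\<Union>n::nat. F \<times> (K \<inter> cball undefined (real n)))"
    by blast
  also have "souslin M \<dots>"
    using assms by (intro souslin_UN souslin_rect closed_Int_compact) auto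
  finally show ?thesis .
qed

text \<open>Souslin sets are not closed under complements. The induction therefore carries the claim
  for \<open>K\<close> and for \<open>- K\<close> at once, so that the complement step merely swaps
  the two.\<close>

lemma souslin_borel_rect:
  fixes K :: "'b::euclidean_space set"
  assumes F: "F \<in> sets M" and "K \<in> sets borel"
  shows "souslin M (F \<times> K)"
proof -
  have "K \<in> sigma_sets UNIV {S. open S}"
    using assms(2) by (simp add: borel_def)
  then have "souslin M (F \<times> K) \<and> souslin M (F \<times> (- K))"
  proof induction
    case (Basic K)
    then obtain C :: "nat \<Rightarrow> 'b set" where "\<And>n. compact (C n)" "(\<Union>n. C n) = K"
      using open_Union_compact_subsets[of K] by (metis mem_Collect_eq)
    moreover from this have "souslin M (\<Union>n. F \<times> C n)"
      by (intro souslin_UN souslin_rect F)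
    moreover have "F \<times> (\<Union>n. C n) = (\<Union>n. F \<times> C n)"
      by blast
    ultimately have "souslin M (F \<times> K)"
      by simp
    then show ?case
      using Basic by (auto intro: souslin_closed_rect F)
  next
    case (Union A)
    have "F \<times> (\<Union>i. A i) = (\<Union>i. F \<times> A i)" "F \<times> (- (\<Union>i. A i)) = (\<Inter>i. F \<times> (- A i))"
      by auto
    with Union show ?case
      by (simp only:) (intro conjI souslin_UN souslin_INT; simp)
  next
    case Empty
    show ?case
      using souslin_closed_rect[OF F, of "{}::'b set"] souslin_closed_rect[OF F, of "UNIV::'b set"] by simp
  next
    case (Compl K)
    then show ?case
      by (simp flip: Compl_eq_Diff_UNIV)
  qed
  then show ?thesis ..
qed

text \<open>The same double induction, with complements relative to the whole product space. The
  hypothesis on \<open>N\<close> admits the Borel sets of the square, the case applied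
  later.\<close>

lemma souslin_pair_measure:
  fixes N :: "'b::euclidean_space measure"
  assumes B: "B \<in> sets (M \<Otimes>\<^sub>M N)" and N: "sets N \<subseteq> sets borel"
  shows "souslin M B"
proof -
  have "B \<in> sigma_sets (space M \<times> space N) {a \<times> b | a b. a \<in> sets M \<and> b \<in> sets N}"
    using B by (simp add: sets_pair_measure)
  then have "souslin M B \<and> souslin M (space M \<times> space N - B)"
  proof induction
    case (Basic B)
    then obtain F K where B: "B = F \<times> K" "F \<in> sets M" "K \<in> sets N"
      by blast
    have "space M \<times> space N - B = (space M - F) \<times> space N \<union> F \<times> (space N - K)"
      using B by (auto dest: sets.sets_into_space)
    then show ?case
      using B N by (auto intro!: souslin_Un souslin_borel_rect)
  next
    case Empty
    show ?case
      using souslin_borel_rect[of "{}" M "{}::'b set"] souslin_borel_rect[of "space M" M "space N"] N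
      by auto
  next
    case (Compl B)
    have "B \<subseteq> space M \<times> space N"
      by (rule sigma_sets_into_sp[OF _ Compl(1)]) (auto dest: sets.sets_into_space)
    then show ?case
      using Compl by (simp add: double_diff)
  next
    case (Union A)
    have "space M \<times> space N - (\<Union>i. A i) = (\<Inter>i. space M \<times> space N - A i)"
      by auto
    with Union show ?case
      by (simp only:) (intro conjI souslin_UN souslin_INT; simp)
  qed
  then show ?thesis ..
qed


section \<open>Capacitability and measurable projection\<close>

text \<open>Koenig's lemma: the bound \<open>m\<close> makes the tree of admissible branches
  finitely branching, so branches that are good up to each finite level yield one that is good at
  all levels.\<close>

lemma scheme_koenig:
  assumes P: "souslin_scheme M P"
    and ne: "\<And>j. \<exists>\<sigma>. (\<forall>i. \<sigma> i \<le> m i) \<and> (\<forall>n\<le>j. w \<in> P n \<sigma>)"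
  shows "\<exists>\<sigma>. \<forall>n. w \<in> P n \<sigma>"
proof -
  \<comment> \<open>The first \<open>k\<close> entries are extendable: for every level
    \<open>j\<close> some bounded branch through them is good up to \<open>j\<close>.\<close>
  define E where "E k \<sigma> \<longleftrightarrow> (\<forall>j. \<exists>\<tau>. (\<forall>i. \<tau> i \<le> m i) \<and> (\<forall>i<k. \<tau> i = \<sigma> i) \<and> (\<forall>n\<le>j. w \<in> P n \<tau>))"
    for k \<sigma>
  have "\<exists>\<sigma>. \<forall>k. E k \<sigma>"
  proof (rule sequence_by_extension)
    show "E 0 (\<lambda>_. 0)"
      using ne by (simp add: E_def)
  next
    fix k \<sigma> assume "E k \<sigma>"
    show "\<exists>a. E (Suc k) (\<sigma>(k := a))"
    proof (rule ccontr)
      assume "\<nexists>a. E (Suc k) (\<sigma>(k := a))"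
      then have "\<forall>a. \<exists>j. \<not> (\<exists>\<tau>. (\<forall>i. \<tau> i \<le> m i) \<and> (\<forall>i<Suc k. \<tau> i = (\<sigma>(k := a)) i) \<and> (\<forall>n\<le>j. w \<in> P n \<tau>))"
        unfolding E_def by blast
      from choice[OF this] obtain j where
        j: "\<And>a. \<not> (\<exists>\<tau>. (\<forall>i. \<tau> i \<le> m i) \<and> (\<forall>i<Suc k. \<tau> i = (\<sigma>(k := a)) i) \<and> (\<forall>n\<le>j a. w \<in> P n \<tau>))"
        by blast
      \<comment> \<open>If each next entry \<open>a\<close> failed at some level \<open>j a\<close>,
        a branch good up to the largest of these levels over the finitely many
        \<open>a \<le> m k\<close> would contradict the failure of its own entry.\<close>
      obtain \<tau> where \<tau>: "\<forall>i. \<tau> i \<le> m i" "\<forall>i<k. \<tau> i = \<sigma> i" "\<forall>n\<le>Max (j ` {..m k}). w \<in> P n \<tau>"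
        using \<open>E k \<sigma>\<close> unfolding E_def by blast
      have "j (\<tau> k) \<le> Max (j ` {..m k})"
        using \<tau>(1) by (intro Max_ge) auto
      then have "\<forall>n\<le>j (\<tau> k). w \<in> P n \<tau>"
        using \<tau>(3) le_trans by blast
      with \<tau>(1,2) have "(\<forall>i. \<tau> i \<le> m i) \<and> (\<forall>i<Suc k. \<tau> i = (\<sigma>(k := \<tau> k)) i) \<and> (\<forall>n\<le>j (\<tau> k). w \<in> P n \<tau>)"
        by (simp add: less_Suc_eq)
      then show False
        using j by blast
    qed
  qed (simp add: E_def)
  then obtain \<sigma> where \<sigma>: "\<And>k. E k \<sigma>"
    by blast
  have "w \<in> P n \<sigma>" for n
  proof -
    obtain \<tau> where "\<forall>i<Suc n. \<tau> i = \<sigma> i" "w \<in> P n \<tau>"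
      using \<sigma>[of "Suc n"] unfolding E_def by blast
    then show ?thesis
      using souslin_schemeD(2)[OF P, of n \<tau> \<sigma>] by simp
  qed
  then show ?thesis
    by blast
qed

text \<open>Choquet capacitability. The entries of the branches are bounded one after another: outer
  measure is continuous along increasing unions even of nonmeasurable sets, so the strict bound by
  \<open>t\<close> survives each stage. The approximations \<open>C j\<close> have measurable
  projections, and continuity of the finite measure from above keeps the bound \<open>t\<close> for
  their intersection \<open>N\<close>.\<close>

theorem souslin_capacitable:
  fixes B :: "('a \<times> 'b::heine_borel) set"
  assumes "finite_measure M" and B: "souslin M B" and t: "t < outer_measure_of M (fst ` B)"
  shows "\<exists>N\<in>sets M. N \<subseteq> fst ` B \<and> t \<le> emeasure M N"
proof -
  interpret finite_measure M by fact
  obtain P where P: "souslin_scheme M P" and B_eq: "B = {w. \<exists>\<sigma>. \<forall>n. w \<in> P n \<sigma>}"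
    using B unfolding souslin_def by blast
  note Pn = souslin_schemeD[OF P]
  define A where "A j m = {w. \<exists>\<sigma>. (\<forall>i<j. \<sigma> i \<le> m i) \<and> (\<forall>n. w \<in> P n \<sigma>)}" for j and m :: "nat \<Rightarrow> nat"
  have A_sub: "fst ` A j m \<subseteq> space M" for j m
  proof -
    have "fst ` A j m \<subseteq> (\<Union>\<sigma>. fst ` P 0 \<sigma>)"
      by (auto simp: A_def)
    also have "\<dots> \<subseteq> space M"
      using compact_rects_fst[OF Pn(1)] sets.sets_into_space by blast
    finally show ?thesis .
  qed
  have "\<exists>m. \<forall>j. t < outer_measure_of M (fst ` A j m)"
  proof (rule sequence_by_extension)
    show "t < outer_measure_of M (fst ` A 0 (\<lambda>_. 0))"
      using t by (simp add: A_def B_eq)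
  next
    fix j m assume "t < outer_measure_of M (fst ` A j m)"
    have "(\<forall>i<Suc j. \<sigma> i \<le> (m(j := a)) i) \<longleftrightarrow> (\<forall>i<j. \<sigma> i \<le> m i) \<and> \<sigma> j \<le> a" for \<sigma> a
      by (auto simp: less_Suc_eq)
    then have A_Suc: "A (Suc j) (m(j := a)) = {w. \<exists>\<sigma>. (\<forall>i<j. \<sigma> i \<le> m i) \<and> \<sigma> j \<le> a \<and> (\<forall>n. w \<in> P n \<sigma>)}" for a
      by (simp add: A_def conj_assoc)
    note \<open>t < outer_measure_of M (fst ` A j m)\<close>
    also have "fst ` A j m = (\<Union>a. fst ` A (Suc j) (m(j := a)))"
    proof -
      have "A j m = (\<Union>a. A (Suc j) (m(j := a)))"
        unfolding A_Suc unfolding A_def by blast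
      then show ?thesis
        by (simp add: image_UN)
    qed
    also have "outer_measure_of M \<dots> = (SUP a. outer_measure_of M (fst ` A (Suc j) (m(j := a))))"
    proof (rule SUP_outer_measure_of_incseq[symmetric])
      show "incseq (\<lambda>a. fst ` A (Suc j) (m(j := a)))"
        unfolding A_Suc by (rule incseq_SucI, rule image_mono) (blast intro: le_SucI)
    qed (rule A_sub)
    finally show "\<exists>a. t < outer_measure_of M (fst ` A (Suc j) (m(j := a)))"
      by (simp add: less_SUP_iff)
  next
    fix j and m m' :: "nat \<Rightarrow> nat"
    assume "\<And>i. i < j \<Longrightarrow> m i = m' i" "t < outer_measure_of M (fst ` A j m)"
    moreover from this have "A j m = A j m'"
      by (simp add: A_def)
    ultimately show "t < outer_measure_of M (fst ` A j m')"
      by simp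
  qed
  then obtain m where m: "\<And>j. t < outer_measure_of M (fst ` A j m)"
    by blast

  \<comment> \<open>Level \<open>n\<close> reads only entries up to \<open>n\<close>, so truncating
    a branch to zero beyond \<open>j\<close> changes no level up to \<open>j\<close> and leaves
    finitely many representatives.\<close>
  define S where "S j = {\<sigma>::nat \<Rightarrow> nat. (\<forall>i\<le>j. \<sigma> i \<le> m i) \<and> (\<forall>i>j. \<sigma> i = 0)}" for j
  have finite_S: "finite (S j)" for j
  proof (rule finite_subset)
    show "S j \<subseteq> {\<sigma>. \<forall>i. (i \<in> {..j} \<longrightarrow> \<sigma> i \<in> {..Max (m ` {..j})}) \<and> (i \<notin> {..j} \<longrightarrow> \<sigma> i = 0)}"
      by (auto simp: S_def intro: order_trans[OF _ Max_ge])
    show "finite \<dots>"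
      by (intro finite_set_of_finite_funs) auto
  qed
  define C where "C j = (\<Union>\<sigma>\<in>S j. \<Inter>n\<in>{..j}. P n \<sigma>)" for j
  have C_rects: "C j \<in> compact_rects M" for j
    unfolding C_def by (intro compact_rects_UN finite_S compact_rects_INT Pn(1)) auto
  have truncate: "w \<in> C j" if "\<forall>i\<le>j. \<sigma> i \<le> m i" "\<forall>n\<le>j. w \<in> P n \<sigma>" for w j \<sigma>
  proof -
    define \<tau> where "\<tau> i = (if i \<le> j then \<sigma> i else 0)" for i
    have "\<tau> \<in> S j"
      using that(1) by (auto simp: S_def \<tau>_def)
    moreover have "w \<in> P n \<tau>" if "n \<le> j" for n
    proof -
      have "P n \<sigma> = P n \<tau>"
        using that by (intro Pn(2)) (simp add: \<tau>_def)
      then show ?thesis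
        using that \<open>\<forall>n\<le>j. w \<in> P n \<sigma>\<close> by blast
    qed
    ultimately show ?thesis
      by (auto simp: C_def)
  qed
  have "C (Suc j) \<subseteq> C j" for j
  proof
    fix w assume "w \<in> C (Suc j)"
    then obtain \<sigma> where "\<sigma> \<in> S (Suc j)" "\<forall>n\<le>Suc j. w \<in> P n \<sigma>"
      by (auto simp: C_def)
    then show "w \<in> C j"
      by (intro truncate[of j \<sigma>]) (auto simp: S_def)
  qed
  then have C_decseq: "decseq C"
    by (rule decseq_SucI)
  define N where "N = (\<Inter>j. fst ` C j)"
  have "N \<in> sets M"
    unfolding N_def using compact_rects_fst[OF C_rects] by (intro sets.countable_INT) auto
  moreover have "N \<subseteq> fst ` B"
  proof
    fix z assume "z \<in> N"
    then have "Pair z -` C j \<noteq> {}" for j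
      by (force simp: N_def)
    \<comment> \<open>Compactness of the sections gives one \<open>x\<close> that serves all
      \<open>j\<close>, so projection commutes with this decreasing intersection.\<close>
    then have "(\<Inter>j. Pair z -` C j) \<noteq> {}"
      using C_decseq
      by (intro compact_nest compact_rects_section[OF C_rects] vimage_mono) (auto dest: decseqD)
    then obtain x where x: "\<And>j. (z, x) \<in> C j"
      by blast
    have "\<exists>\<sigma>. \<forall>n. (z, x) \<in> P n \<sigma>"
    proof (rule scheme_koenig[OF P])
      fix j
      obtain \<sigma> where "\<sigma> \<in> S j" "\<forall>n\<le>j. (z, x) \<in> P n \<sigma>"
        using x[of j] by (auto simp: C_def)
      moreover from this have "\<sigma> i \<le> m i" for i
        by (cases "i \<le> j") (auto simp: S_def)
      ultimately show "\<exists>\<sigma>. (\<forall>i. \<sigma> i \<le> m i) \<and> (\<forall>n\<le>j. (z, x) \<in> P n \<sigma>)"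
        by blast
    qed
    then show "z \<in> fst ` B"
      by (force simp: B_eq)
  qed
  moreover have "t \<le> emeasure M N"
  proof -
    have "t \<le> emeasure M (fst ` C j)" for j
    proof -
      \<comment> \<open>The index is shifted by one: \<open>A (Suc j) m\<close> bounds the entries 0
        to \<open>j\<close>, exactly those bounded in \<open>S j\<close>.\<close>
      have "A (Suc j) m \<subseteq> C j"
        by (auto simp: A_def less_Suc_eq_le intro: truncate)
      then have "outer_measure_of M (fst ` A (Suc j) m) \<le> outer_measure_of M (fst ` C j)"
        by (intro outer_measure_of_mono image_mono)
      then show ?thesis
        using m[of "Suc j"] compact_rects_fst[OF C_rects] by simp
    qed
    moreover have "(INF j. emeasure M (fst ` C j)) = emeasure M N"
      unfolding N_def using C_decseq compact_rects_fst[OF C_rects]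
      by (intro INF_emeasure_decseq) (auto simp: decseq_def)
    ultimately show ?thesis
      by (metis INF_greatest)
  qed
  ultimately show ?thesis
    by blast
qed

text \<open>The outer set is a measurable hull. The inner set is a countable union of capacitability
  approximations whose defects tend to zero.\<close>

theorem measurable_projection_sandwich:
  fixes N :: "'b::euclidean_space measure"
  assumes "finite_measure M" and B: "B \<in> sets (M \<Otimes>\<^sub>M N)" and N: "sets N \<subseteq> sets borel"
  shows "\<exists>S\<in>sets M. \<exists>T\<in>sets M. S \<subseteq> fst ` B \<and> fst ` B \<subseteq> T \<and> emeasure M (T - S) = 0"
proof -
  interpret finite_measure M by fact
  have "fst ` B \<subseteq> space M"
    using sets.sets_into_space[OF B] by (auto simp: space_pair_measure)
  then obtain T where T: "T \<in> sets M" "fst ` B \<subseteq> T" "outer_measure_of M (fst ` B) = emeasure M T"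
    using outer_measure_of_attain[of "fst ` B" M] by blast
  have "\<exists>S. S \<in> sets M \<and> S \<subseteq> fst ` B \<and> measure M T - 1 / Suc n \<le> measure M S" for n
  \<comment> \<open>Capacitability needs a value strictly below the outer measure, and
    \<open>ennreal\<close> truncates negative numbers to 0, so measure zero is a separate
    case.\<close>
  proof (cases "measure M T = 0")
    case True
    then show ?thesis
      by (intro exI[of _ "{}"]) simp
  next
    case False
    then have "0 < measure M T"
      by (simp add: zero_less_measure_iff)
    then have "ennreal (measure M T - 1 / Suc n) < outer_measure_of M (fst ` B)"
      unfolding T(3) emeasure_eq_measure by (intro ennreal_lessI) simp_all
    then obtain S where S: "S \<in> sets M" "S \<subseteq> fst ` B" "ennreal (measure M T - 1 / Suc n) \<le> emeasure M S"
      using souslin_capacitable[OF assms(1) souslin_pair_measure[OF B N]] by blast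
    then have "measure M T - 1 / Suc n \<le> measure M S"
      by (simp add: emeasure_eq_measure ennreal_le_iff)
    with S show ?thesis
      by blast
  qed
  then obtain S where S: "\<And>n. S n \<in> sets M" "\<And>n. S n \<subseteq> fst ` B"
      "\<And>n. measure M T - 1 / Suc n \<le> measure M (S n)"
    by metis
  have le: "measure M (T - (\<Union>n. S n)) \<le> 1 / Suc n" for n
  proof -
    have "measure M (T - (\<Union>n. S n)) \<le> measure M (T - S n)"
      using S(1) T(1) by (intro finite_measure_mono) auto
    also have "\<dots> = measure M T - measure M (S n)"
      using S(1) T(1) subset_trans[OF S(2) T(2)] by (intro finite_measure_Diff) auto
    also have "\<dots> \<le> 1 / Suc n"
      using S(3)[of n] by simp
    finally show ?thesis .
  qed
  have "measure M (T - (\<Union>n. S n)) \<le> 0"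
    by (rule field_le_epsilon) (metis le add_0 nat_approx_posE order.trans less_imp_le)
  then have "emeasure M (T - (\<Union>n. S n)) = 0"
    by (simp add: emeasure_eq_measure measure_le_0_iff)
  then show ?thesis
    using S(1,2) T(1,2) by (intro bexI[of _ "\<Union>n. S n"] bexI[of _ T]) auto
qed

subsection \<open>The two hypotheses\<close>

text \<open>In the type \<open>2\<close> the index other than \<open>k\<close> is \<open>k + 1\<close>. The maps \<open>twist k d a\<close> play the role of the
  inverses \<open>f\<^sub>*\<^sup>-\<^sup>1\<close>: \<open>squeeze d\<close> sends the middle half of the interval onto \<open>[- d, d]\<close>, and \<open>shear a\<close>
  moves points along coordinate \<open>k\<close> inside that middle half only.\<close>

definition squeeze :: "real \<Rightarrow> real \<Rightarrow> real" where
  "squeeze d t = 2 * d * t + (1 - 2 * d) * (max 0 (2 * t - 1) - max 0 (- 2 * t - 1))"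

definition shear :: "real \<Rightarrow> real \<Rightarrow> real \<Rightarrow> real" where
  "shear a s t = t + a * max 0 (1 - 2 * \<bar>s\<bar>) * (1 - \<bar>t\<bar>) / 2"

definition twist :: "2 \<Rightarrow> real \<Rightarrow> real \<Rightarrow> real^2 \<Rightarrow> real^2" where
  "twist k d a y = (\<chi> i. if i = k then shear a (y $ (k + 1)) (y $ k) else squeeze d (y $ i))"

section \<open>Distortion estimates and membership in the class\<close>

text \<open>The graph is piecewise linear with slope \<open>2 * d\<close> on the middle half and
  \<open>2 - 2 * d\<close> outside it. The function \<open>g\<close> isolates the part that is flat
  on the middle half.\<close>

lemma squeeze_diff:
  assumes "0 < d" "d \<le> 1/2" "s \<le> t"
  shows "2 * d * (t - s) \<le> squeeze d t - squeeze d s" "squeeze d t - squeeze d s \<le> 2 * (t - s)"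
proof -
  define g where "g t = max 0 (2 * t - 1) - max 0 (- 2 * t - 1)" for t :: real
  have g: "0 \<le> g t - g s" "g t - g s \<le> 2 * (t - s)"
    using assms by (auto simp: g_def max_def)
  have eq: "squeeze d t - squeeze d s = 2 * d * (t - s) + (1 - 2 * d) * (g t - g s)"
    by (simp add: squeeze_def g_def algebra_simps)
  have "0 \<le> (1 - 2 * d) * (g t - g s)" "(1 - 2 * d) * (g t - g s) \<le> (1 - 2 * d) * (2 * (t - s))"
    using assms g by (auto intro!: mult_nonneg_nonneg mult_left_mono)
  moreover have "0 \<le> d * (t - s)"
    using assms by simp
  ultimately show "2 * d * (t - s) \<le> squeeze d t - squeeze d s" "squeeze d t - squeeze d s \<le> 2 * (t - s)"
    unfolding eq by (auto simp: algebra_simps)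
qed

lemma squeeze_abs_diff:
  assumes "0 < d" "d \<le> 1/2"
  shows "2 * d * \<bar>s - t\<bar> \<le> \<bar>squeeze d s - squeeze d t\<bar>" "\<bar>squeeze d s - squeeze d t\<bar> \<le> 2 * \<bar>s - t\<bar>"
proof -
  have *: "0 \<le> d * (v - u)" if "u \<le> v" for u v
    using assms that by simp
  show "2 * d * \<bar>s - t\<bar> \<le> \<bar>squeeze d s - squeeze d t\<bar>" "\<bar>squeeze d s - squeeze d t\<bar> \<le> 2 * \<bar>s - t\<bar>"
    using squeeze_diff[OF assms, of s t] squeeze_diff[OF assms, of t s] *[of s t] *[of t s]
    by (cases "s \<le> t"; simp add: abs_if algebra_simps)+
qed

lemma squeeze_ends: "squeeze d (- 1) = - 1" "squeeze d 1 = 1"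
  by (simp_all add: squeeze_def)

lemma squeeze_inner: "\<bar>t\<bar> \<le> 1/2 \<Longrightarrow> squeeze d t = 2 * d * t"
  by (simp add: squeeze_def max_def abs_if split: if_splits)

text \<open>With the tent \<open>b\<close>, which is at most 1 and 2-Lipschitz, the difference is
  \<open>t - t'\<close> plus \<open>u\<close> from the change of \<open>t\<close> and
  \<open>v\<close> from the change of \<open>s\<close>. The final division by 2 in
  \<open>shear\<close> keeps the slope in \<open>t\<close> between 1/2 and 3/2.\<close>

lemma shear_abs_diff:
  assumes a: "0 \<le> a" "a \<le> 1" and "\<bar>t\<bar> \<le> 1" "\<bar>t'\<bar> \<le> 1"
  shows "\<bar>t - t'\<bar> / 2 - \<bar>s - s'\<bar> \<le> \<bar>shear a s t - shear a s' t'\<bar>"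
    "\<bar>shear a s t - shear a s' t'\<bar> \<le> 2 * \<bar>t - t'\<bar> + \<bar>s - s'\<bar>"
proof -
  define b where "b s = a * max 0 (1 - 2 * \<bar>s\<bar>)" for s :: real
  have b: "0 \<le> b s" "b s \<le> 1" for s
  proof -
    show "0 \<le> b s"
      using a by (simp add: b_def)
    have "b s \<le> 1 * 1"
      unfolding b_def using a by (intro mult_mono) auto
    then show "b s \<le> 1"
      by simp
  qed
  have b_diff: "\<bar>b s - b s'\<bar> \<le> 2 * \<bar>s - s'\<bar>"
  proof -
    have "\<bar>b s - b s'\<bar> = a * \<bar>max 0 (1 - 2 * \<bar>s\<bar>) - max 0 (1 - 2 * \<bar>s'\<bar>)\<bar>"
      using a by (simp add: b_def abs_mult flip: right_diff_distrib)
    also have "\<dots> \<le> 1 * \<bar>max 0 (1 - 2 * \<bar>s\<bar>) - max 0 (1 - 2 * \<bar>s'\<bar>)\<bar>"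
      using a by (intro mult_right_mono) auto
    also have "\<dots> \<le> 2 * \<bar>s - s'\<bar>"
      by (auto simp: max_def abs_if)
    finally show ?thesis .
  qed
  define u where "u = (\<bar>t'\<bar> - \<bar>t\<bar>) * b s / 2"
  define v where "v = (b s - b s') * (1 - \<bar>t'\<bar>) / 2"
  have eq: "shear a s t - shear a s' t' = (t - t') + u + v"
    by (simp add: shear_def b_def u_def v_def field_simps)
  have "\<bar>\<bar>t'\<bar> - \<bar>t\<bar>\<bar> * b s \<le> \<bar>t - t'\<bar> * 1"
    using b by (intro mult_mono) auto
  then have u: "\<bar>u\<bar> \<le> \<bar>t - t'\<bar> / 2"
    using b by (simp add: u_def abs_mult)
  have "\<bar>b s - b s'\<bar> * \<bar>1 - \<bar>t'\<bar>\<bar> \<le> (2 * \<bar>s - s'\<bar>) * 1"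
    using b_diff assms by (intro mult_mono) auto
  then have v: "\<bar>v\<bar> \<le> \<bar>s - s'\<bar>"
    by (simp add: v_def abs_mult)
  show "\<bar>t - t'\<bar> / 2 - \<bar>s - s'\<bar> \<le> \<bar>shear a s t - shear a s' t'\<bar>"
    unfolding eq using u v abs_triangle_ineq[of "t - t' + u + v" "- u - v"] abs_triangle_ineq4[of "- u" v]
    by simp
  show "\<bar>shear a s t - shear a s' t'\<bar> \<le> 2 * \<bar>t - t'\<bar> + \<bar>s - s'\<bar>"
  proof -
    have "\<bar>t - t' + u + v\<bar> \<le> \<bar>t - t'\<bar> + \<bar>u\<bar> + \<bar>v\<bar>"
      by linarith
    also have "\<dots> \<le> \<bar>t - t'\<bar> + \<bar>t - t'\<bar> / 2 + \<bar>s - s'\<bar>"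
      using u v by (intro add_mono) auto
    also have "\<dots> \<le> 2 * \<bar>t - t'\<bar> + \<bar>s - s'\<bar>"
      by simp
    finally show ?thesis
      unfolding eq .
  qed
qed

lemma shear_range:
  assumes "0 \<le> a" "a \<le> 1" "\<bar>t\<bar> \<le> 1"
  shows "\<bar>shear a s t\<bar> \<le> 1"
proof -
  define p where "p = a * max 0 (1 - 2 * \<bar>s\<bar>) * (1 - \<bar>t\<bar>)"
  have "a * max 0 (1 - 2 * \<bar>s\<bar>) \<le> 1 * 1"
    using assms by (intro mult_mono) auto
  then have "p \<le> 1 * (1 - \<bar>t\<bar>)"
    unfolding p_def using assms by (intro mult_right_mono) auto
  moreover have "0 \<le> p"
    unfolding p_def using assms by (intro mult_nonneg_nonneg) auto
  ultimately have "\<bar>t + p / 2\<bar> \<le> 1"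
    using assms(3) by (cases "0 \<le> t") (simp_all add: abs_le_iff)
  then show ?thesis
    by (simp add: shear_def p_def)
qed

lemma index_2: "i = k \<or> i = k + 1" "k + 1 \<noteq> k" for i k :: 2
  using exhaust_2[of i] exhaust_2[of k] by auto

lemma norm_le_2: "norm (x :: real^2) \<le> \<bar>x $ k\<bar> + \<bar>x $ (k + 1)\<bar>"
proof -
  have UNIV: "(UNIV :: 2 set) = {k, k + 1}"
    using index_2(1) by blast
  have "(\<Sum>i\<in>UNIV. \<bar>x $ i\<bar>) = \<bar>x $ k\<bar> + \<bar>x $ (k + 1)\<bar>"
    unfolding UNIV using index_2(2)[of k] by (subst sum.insert) auto
  then show ?thesis
    using norm_le_l1_cart[of x] by simp
qed

lemma square_iff: "x \<in> square \<longleftrightarrow> (\<forall>i. \<bar>x $ i\<bar> \<le> 1)"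
  by (auto simp: square_def abs_le_iff minus_le_iff)

lemma twist_k [simp]: "twist k d a y $ k = shear a (y $ (k + 1)) (y $ k)"
  and twist_j [simp]: "twist k d a y $ (k + 1) = squeeze d (y $ (k + 1))"
  using index_2(2)[of k] by (auto simp: twist_def)

text \<open>The map is triangular: coordinate \<open>k + 1\<close> of the image controls
  \<open>s\<close> alone, and then coordinate \<open>k\<close> controls \<open>r\<close>. The 5
  comes from \<open>2 * r + 3 * s\<close>, and \<open>2 / d\<close> rounds up the loss 3/(2d) due to
  the slope \<open>2 * d\<close>.\<close>

lemma twist_bilipschitz:
  assumes d: "0 < d" "d \<le> 1/2" and a: "0 \<le> a" "a \<le> 1"
    and "x \<in> square" "x' \<in> square"
  shows "inverse (2 / d + 5) * norm (x - x') \<le> norm (twist k d a x - twist k d a x')"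
    "norm (twist k d a x - twist k d a x') \<le> (2 / d + 5) * norm (x - x')"
proof -
  let ?D = "twist k d a x - twist k d a x'"
  define s where "s = \<bar>(x - x') $ (k + 1)\<bar>"
  define r where "r = \<bar>(x - x') $ k\<bar>"
  have "\<bar>x $ k\<bar> \<le> 1" "\<bar>x' $ k\<bar> \<le> 1"
    using assms(5,6) by (auto simp: square_iff)
  then have k: "r / 2 - s \<le> \<bar>?D $ k\<bar>" "\<bar>?D $ k\<bar> \<le> 2 * r + s"
    using shear_abs_diff[OF a, of "x $ k" "x' $ k" "x $ (k + 1)" "x' $ (k + 1)"]
    by (simp_all add: s_def r_def)
  have j: "2 * d * s \<le> \<bar>?D $ (k + 1)\<bar>" "\<bar>?D $ (k + 1)\<bar> \<le> 2 * s"
    using squeeze_abs_diff[OF d, of "x $ (k + 1)" "x' $ (k + 1)"] by (simp_all add: s_def)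
  have "norm (x - x') \<le> r + s"
    using norm_le_2[of "x - x'" k] by (simp add: s_def r_def)
  also have "\<dots> \<le> 2 * \<bar>?D $ k\<bar> + 3 * s"
    using k(1) by linarith
  also have "3 * s \<le> 2 / d * \<bar>?D $ (k + 1)\<bar>"
  proof -
    have "0 \<le> s"
      by (simp add: s_def)
    have "3 * s \<le> 2 / d * (2 * d * s)"
      using d \<open>0 \<le> s\<close> by simp
    also have "\<dots> \<le> 2 / d * \<bar>?D $ (k + 1)\<bar>"
      using j(1) d by (intro mult_left_mono) auto
    finally show ?thesis .
  qed
  also have "2 * \<bar>?D $ k\<bar> + 2 / d * \<bar>?D $ (k + 1)\<bar> \<le> 5 * norm ?D + 2 / d * norm ?D"
    using d component_le_norm_cart[of ?D k] component_le_norm_cart[of ?D "k + 1"]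
    by (intro add_mono mult_left_mono mult_mono) auto
  finally have "norm (x - x') \<le> (2 / d + 5) * norm ?D"
    by (simp add: algebra_simps)
  moreover have pos: "0 < 2 / d + 5"
    using d by (simp add: add_pos_pos)
  ultimately show "inverse (2 / d + 5) * norm (x - x') \<le> norm ?D"
    by (simp only: mult.commute[of "inverse _"] divide_inverse[symmetric] pos_divide_le_eq mult.commute)
  have "norm ?D \<le> \<bar>?D $ k\<bar> + \<bar>?D $ (k + 1)\<bar>"
    by (rule norm_le_2)
  also have "\<dots> \<le> 2 * r + 3 * s"
    using k(2) j(2) by linarith
  also have "\<dots> \<le> 5 * norm (x - x')"
    using component_le_norm_cart[of "x - x'" k] component_le_norm_cart[of "x - x'" "k + 1"]
    unfolding r_def s_def by linarith
  also have "\<dots> \<le> (2 / d + 5) * norm (x - x')"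
    using d by (intro mult_right_mono) auto
  finally show "norm ?D \<le> (2 / d + 5) * norm (x - x')" .
qed

lemma twist_in_class:
  assumes d: "0 < d" "d \<le> 1/2" and a: "0 \<le> a" "a \<le> 1"
  shows "twist k d a \<in> bilipschitz_bijections"
proof -
  have pos: "0 < 2 / d + 5"
    using d by (simp add: add_pos_pos)
  have inj: "inj_on (twist k d a) square"
  proof (rule inj_onI)
    fix x x' assume "x \<in> square" "x' \<in> square" "twist k d a x = twist k d a x'"
    then have "inverse (2 / d + 5) * norm (x - x') \<le> 0"
      using twist_bilipschitz(1)[OF assms, of x x' k] by simp
    then show "x = x'"
      using pos by (simp add: mult_le_0_iff not_le[symmetric])
  qed
  have squeeze_range: "\<bar>squeeze d t\<bar> \<le> 1" if "\<bar>t\<bar> \<le> 1" for t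
  proof -
    have "0 \<le> d * (1 - t)" "0 \<le> d * (t - (- 1))"
      using that d by (auto intro!: mult_nonneg_nonneg)
    then show ?thesis
      using squeeze_diff(1)[OF d, of t 1] squeeze_diff(1)[OF d, of "- 1" t] that
      by (simp add: squeeze_ends abs_le_iff)
  qed
  have "twist k d a ` square = square"
  proof
    show "twist k d a ` square \<subseteq> square"
      by (auto simp: square_iff twist_def intro!: shear_range a squeeze_range)
    \<comment> \<open>Solve coordinate \<open>k + 1\<close> for \<open>s\<close> first, then
      coordinate \<open>k\<close> for \<open>t\<close> with this \<open>s\<close>; both
      one-dimensional maps fix the endpoints, so the intermediate value theorem applies.\<close>
    show "square \<subseteq> twist k d a ` square"
    proof
      fix x assume x: "x \<in> square"
      then have x: "- 1 \<le> x $ i" "x $ i \<le> 1" for i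
        by (auto simp: square_def)
      have "continuous_on {- 1..1} (squeeze d)"
        unfolding squeeze_def by (intro continuous_intros)
      then obtain s where s: "- 1 \<le> s" "s \<le> 1" "squeeze d s = x $ (k + 1)"
        using IVT'[of "squeeze d" "- 1" "x $ (k + 1)" 1] x by (auto simp: squeeze_ends)
      have "continuous_on {- 1..1} (shear a s)"
        unfolding shear_def by (intro continuous_intros) auto
      then obtain t where t: "- 1 \<le> t" "t \<le> 1" "shear a s t = x $ k"
        using IVT'[of "shear a s" "- 1" "x $ k" 1] x by (auto simp: shear_def)
      define y :: "real^2" where "y = (\<chi> i. if i = k then t else s)"
      have y: "y $ k = t" "y $ (k + 1) = s"
        using index_2(2)[of k] by (simp_all add: y_def)
      have "twist k d a y $ i = x $ i" for i
        using index_2(1)[of i k] s t y by auto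
      then have "twist k d a y = x"
        by (simp add: vec_eq_iff)
      moreover have "y \<in> square"
        using s t by (auto simp: y_def square_def)
      ultimately show "x \<in> twist k d a ` square"
        by blast
    qed
  qed
  moreover have "1 \<le> 2 / d + 5"
    using d by (simp add: add_nonneg_nonneg add.commute add_increasing2)
  ultimately show ?thesis
    unfolding bilipschitz_bijections_def bij_betw_def
    using inj twist_bilipschitz[OF assms] by blast
qed

lemma inv_into_in_class:
  assumes "f \<in> bilipschitz_bijections"
  shows "inv_into square f \<in> bilipschitz_bijections"
proof -
  obtain L where bij: "bij_betw f square square" and L: "1 \<le> L"
    and bound: "\<And>x x'. x \<in> square \<Longrightarrow> x' \<in> square \<Longrightarrow> inverse L * norm (x - x') \<le> norm (f x - f x')"
      "\<And>x x'. x \<in> square \<Longrightarrow> x' \<in> square \<Longrightarrow> norm (f x - f x') \<le> L * norm (x - x')"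
    using assms unfolding bilipschitz_bijections_def by blast
  let ?g = "inv_into square f"
  have g: "?g y \<in> square" "f (?g y) = y" if "y \<in> square" for y
    using bij that by (auto simp: bij_betw_def intro: inv_into_into f_inv_into_f)
  have "inverse L * norm (y - y') \<le> norm (?g y - ?g y') \<and> norm (?g y - ?g y') \<le> L * norm (y - y')"
    if "y \<in> square" "y' \<in> square" for y y'
    using bound[of "?g y" "?g y'"] g[OF that(1)] g[OF that(2)] L
    by (simp add: field_simps)
  then show ?thesis
    using bij_betw_inv_into[OF bij] L unfolding bilipschitz_bijections_def by blast
qed

text \<open>A preimage of a point off the strip lies outside the middle half, because
  \<open>squeeze d\<close> sends that half into the strip. There the tent of \<open>shear\<close>
  vanishes, so both maps take the same value at this preimage.\<close>

lemma inv_twist_agree: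
  assumes d: "0 < d" "d \<le> 1/2" and x: "x \<in> square" "d < \<bar>x $ (k + 1)\<bar>"
  shows "inv_into square (twist k d 0) x = inv_into square (twist k d 1) x"
proof -
  have bij: "bij_betw (twist k d a) square square" if "a \<in> {0, 1}" for a
    using twist_in_class[OF d, of a k] that by (auto simp: bilipschitz_bijections_def)
  obtain y where y: "y \<in> square" "twist k d 0 y = x"
    using bij[of 0] x(1) unfolding bij_betw_def by (metis imageE insertI1)
  have "\<not> \<bar>y $ (k + 1)\<bar> \<le> 1/2"
  proof
    assume *: "\<bar>y $ (k + 1)\<bar> \<le> 1/2"
    have "x $ (k + 1) = 2 * d * y $ (k + 1)"
      using squeeze_inner[OF *, of d] y(2) by auto
    then have "\<bar>x $ (k + 1)\<bar> \<le> 2 * d * (1/2)"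
      using * d by (simp add: abs_mult)
    then show False
      using x(2) by simp
  qed
  then have "shear 1 (y $ (k + 1)) (y $ k) = shear 0 (y $ (k + 1)) (y $ k)"
    by (simp add: shear_def max_def)
  then have "twist k d 1 y = twist k d 0 y"
    by (simp add: twist_def vec_eq_iff)
  with y(2) have "twist k d 1 y = x"
    by simp
  then show ?thesis
    using y bij by (metis bij_betw_def insertCI inv_into_f_f)
qed

subsection \<open>Sample laws\<close>

lemma prob_space_noise_law:
  assumes "0 < s"
  shows "prob_space (noise_law s)"
proof
  \<comment> \<open>Integration of products over \<open>lborel\<close> runs over inner products with
    \<open>Basis\<close>, so the coordinates are reindexed by axis vectors.\<close>
  have Basis: "(Basis :: (real^2) set) = (\<lambda>i. axis i 1) ` UNIV"
    by (auto simp: Basis_vec_def)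
  have "(\<integral>\<^sup>+ e. ennreal (\<Prod>i\<in>UNIV. normal_density 0 s (e $ i)) \<partial>(lborel :: (real^2) measure)) =
    (\<integral>\<^sup>+ e. (\<Prod>b\<in>Basis. ennreal (normal_density 0 s (e \<bullet> b))) \<partial>(lborel :: (real^2) measure))"
    by (intro nn_integral_cong)
      (simp add: Basis prod.reindex inj_on_def axis_eq_axis cart_eq_inner_axis prod_ennreal)
  also have "\<dots> = (\<Prod>b\<in>(Basis :: (real^2) set). \<integral>\<^sup>+ x. ennreal (normal_density 0 s x) \<partial>lborel)"
    by (rule nn_integral_lborel_prod) auto
  also have "(\<integral>\<^sup>+ x. ennreal (normal_density 0 s x) \<partial>lborel) = 1"
    using prob_space.emeasure_space_1[OF prob_space_normal_density[OF assms, of 0]]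
    by (simp add: emeasure_density)
  finally show "emeasure (noise_law s) (space (noise_law s)) = 1"
    by (simp add: noise_law_def emeasure_density)
qed

lemma sets_noise_law [measurable_cong, simp]: "sets (noise_law s) = sets borel"
  and space_noise_law [simp]: "space (noise_law s) = UNIV"
  by (simp_all add: noise_law_def)

lemma closed_square: "closed square"
proof -
  have "square = (\<Inter>i. {x. - 1 \<le> x $ i} \<inter> {x. x $ i \<le> 1})"
    by (auto simp: square_def)
  also have "closed \<dots>"
    by (intro closed_INT ballI closed_Int closed_Collect_le continuous_intros)
  finally show ?thesis .
qed

lemma space_borel_square [simp]: "space borel_square = square"
  by (simp add: space_restrict_space)

lemma sets_borel_square_subset: "sets borel_square \<subseteq> sets borel"
  using closed_square by (auto simp: sets_restrict_space)

lemma measurable_borel_square_borel [measurable]: "(\<lambda>x. x) \<in> borel_square \<rightarrow>\<^sub>M borel"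
  by (rule measurable_restrict_space1) simp

lemma bilipschitz_bijections_measurable:
  assumes "f \<in> bilipschitz_bijections"
  shows "f \<in> borel_square \<rightarrow>\<^sub>M borel"
proof -
  obtain L where L: "1 \<le> L" "\<And>x x'. x \<in> square \<Longrightarrow> x' \<in> square \<Longrightarrow> norm (f x - f x') \<le> L * norm (x - x')"
    using assms unfolding bilipschitz_bijections_def by blast
  then have "L-lipschitz_on square f"
    by (intro lipschitz_onI) (auto simp: dist_norm)
  then show ?thesis
    by (intro borel_measurable_continuous_on_restrict lipschitz_on_continuous_on)
qed

section \<open>The avoidance event and the coupling of samples\<close>

lemma avoid_eq_PiE:
  "{D \<in> space (sample_space n). \<forall>i<n. fst (D i) \<notin> S} = (\<Pi>\<^sub>E i\<in>{..<n}. (square - S) \<times> UNIV)"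
proof -
  have "space (sample_space n) = (\<Pi>\<^sub>E i\<in>{..<n}. square \<times> UNIV)"
    by (simp add: sample_space_def space_PiM space_pair_measure)
  then show ?thesis
    by (simp add: set_eq_iff PiE_iff mem_Times_iff) blast
qed

lemma square_Diff_times_UNIV:
  assumes "S \<in> sets borel_square"
  shows "(square - S) \<times> UNIV \<in> sets (borel_square \<Otimes>\<^sub>M borel)"
proof -
  have "square - S \<in> sets borel_square"
    using sets.compl_sets[OF assms] by simp
  then show ?thesis
    by (rule pair_measureI) simp
qed

lemma avoid_in_sets:
  assumes "S \<in> sets borel_square"
  shows "{D \<in> space (sample_space n). \<forall>i<n. fst (D i) \<notin> S} \<in> sets (sample_space n)"
  unfolding avoid_eq_PiE unfolding sample_space_def
  by (intro sets_PiM_I_finite square_Diff_times_UNIV assms) simp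

context
  fixes P :: "(real^2) measure" and s :: real and f :: "real^2 \<Rightarrow> real^2"
  assumes P: "prob_space P" "sets P = sets borel_square"
    and s: "0 < s"
    and f [measurable]: "f \<in> borel_square \<rightarrow>\<^sub>M borel"
begin

lemma observation_map_measurable:
  "(\<lambda>(x, e). (x, f x + e)) \<in> P \<Otimes>\<^sub>M noise_law s \<rightarrow>\<^sub>M borel_square \<Otimes>\<^sub>M borel"
proof -
  note [measurable_cong] = P(2)
  show ?thesis
    by measurable
qed

lemma prob_space_design_noise: "prob_space (P \<Otimes>\<^sub>M noise_law s)"
  by (intro prob_space_pair P(1) prob_space_noise_law s)

lemma prob_space_observation_law: "prob_space (observation_law P s f)"
  unfolding observation_law_def
  by (rule prob_space.prob_space_distr[OF prob_space_design_noise observation_map_measurable])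

lemma sets_sample_law: "sets (sample_law P s n f) = sets (sample_space n)"
  unfolding sample_law_def sample_space_def observation_law_def
  by (intro sets_PiM_cong) auto

lemma prob_space_sample_law: "prob_space (sample_law P s n f)"
  unfolding sample_law_def by (intro prob_space_PiM prob_space_observation_law)

text \<open>Puts the samples for all \<open>f\<close> on one space of design points and noise. This
  coupling makes two regression functions comparable draw by draw.\<close>

lemma sample_law_eq_distr:
  "sample_law P s n f =
    distr (\<Pi>\<^sub>M i\<in>{..<n}. P \<Otimes>\<^sub>M noise_law s) (sample_space n) (compose {..<n} (\<lambda>(x, e). (x, f x + e)))"
proof -
  let ?F = "\<lambda>(x, e). (x, f x + e)"
  have obs: "distr (P \<Otimes>\<^sub>M noise_law s) (observation_law P s f) ?F = observation_law P s f"
    unfolding observation_law_def by (intro distr_cong) auto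
  have "distr (\<Pi>\<^sub>M i\<in>{..<n}. P \<Otimes>\<^sub>M noise_law s) (\<Pi>\<^sub>M i\<in>{..<n}. observation_law P s f) (compose {..<n} ?F)
    = (\<Pi>\<^sub>M i\<in>{..<n}. distr (P \<Otimes>\<^sub>M noise_law s) (observation_law P s f) ?F)"
    by (intro distr_PiM_finite_prob_space' prob_space_design_noise prob_space_observation_law)
      (simp_all add: observation_law_def observation_map_measurable)
  then have "sample_law P s n f =
    distr (\<Pi>\<^sub>M i\<in>{..<n}. P \<Otimes>\<^sub>M noise_law s) (sample_law P s n f) (compose {..<n} ?F)"
    unfolding obs sample_law_def[symmetric] by simp
  also have "\<dots> = distr (\<Pi>\<^sub>M i\<in>{..<n}. P \<Otimes>\<^sub>M noise_law s) (sample_space n) (compose {..<n} ?F)"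
    by (rule distr_cong) (simp_all add: sets_sample_law)
  finally show ?thesis .
qed

lemma emeasure_sample_law_avoid:
  assumes S: "S \<in> sets P"
  shows "emeasure (sample_law P s n f) {D \<in> space (sample_space n). \<forall>i<n. fst (D i) \<notin> S}
    = ennreal ((1 - measure P S) ^ n)"
proof -
  note design_sets = P(2)
  have design_space: "space P = square"
    using sets_eq_imp_space_eq[OF P(2)] by simp
  interpret design: prob_space P by fact
  interpret noise: prob_space "noise_law s"
    by (rule prob_space_noise_law[OF s])
  interpret obs: prob_space "observation_law P s f"
    by (rule prob_space_observation_law)
  interpret product_prob_space "\<lambda>_. observation_law P s f" "{..<n}"
    by (rule product_prob_spaceI) (rule prob_space_observation_law)
  have SU: "(square - S) \<times> UNIV \<in> sets (borel_square \<Otimes>\<^sub>M borel)"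
    using S design_sets by (intro square_Diff_times_UNIV) simp
  note eq = avoid_eq_PiE[of n S]
  have "emeasure (observation_law P s f) ((square - S) \<times> UNIV)
    = emeasure (P \<Otimes>\<^sub>M noise_law s) ((space P - S) \<times> space (noise_law s))"
    unfolding observation_law_def using SU
    by (subst emeasure_distr) (auto simp: observation_map_measurable space_pair_measure design_space intro!: arg_cong2[where f=emeasure])
  also have "\<dots> = emeasure P (space P - S)"
    using S by (subst noise.emeasure_pair_measure_Times) (auto simp: noise.emeasure_space_1[simplified])
  also have "\<dots> = ennreal (1 - measure P S)"
    using S by (simp add: design.emeasure_eq_measure design.prob_compl)
  finally have obs: "emeasure (observation_law P s f) ((square - S) \<times> UNIV) = ennreal (1 - measure P S)" .
  have "emeasure (sample_law P s n f) (\<Pi>\<^sub>E i\<in>{..<n}. (square - S) \<times> UNIV)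
    = (\<Prod>i<n. emeasure (observation_law P s f) ((square - S) \<times> UNIV))"
    unfolding sample_law_def using SU by (intro emeasure_PiM) (auto simp: observation_law_def)
  then show ?thesis
    by (simp add: eq obs ennreal_power)
qed

end

text \<open>Under the coupling both samples share their design points. If one of these lies in
  \<open>S\<close>, then \<open>h\<close> vanishes on both samples; otherwise the samples
  coincide.\<close>

lemma sample_law_agree:
  assumes P: "prob_space P" "sets P = sets borel_square" and s: "0 < s"
    and f [measurable]: "f \<in> borel_square \<rightarrow>\<^sub>M borel" "f' \<in> borel_square \<rightarrow>\<^sub>M borel"
    and agree: "\<And>x. x \<in> square \<Longrightarrow> x \<notin> S \<Longrightarrow> f x = f' x"
    and h: "h \<in> borel_measurable (sample_space n)"
    and h0: "\<And>D i. i < n \<Longrightarrow> fst (D i) \<in> S \<Longrightarrow> h D = 0"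
  shows "(\<integral>\<^sup>+ D. h D \<partial>sample_law P s n f) = (\<integral>\<^sup>+ D. h D \<partial>sample_law P s n f')"
proof -
  let ?W = "\<Pi>\<^sub>M i\<in>{..<n}. P \<Otimes>\<^sub>M noise_law s"
  let ?F = "\<lambda>f. compose {..<n} (\<lambda>(x, e). (x, f x + e))"
  have meas: "?F f \<in> ?W \<rightarrow>\<^sub>M sample_space n" if "f \<in> borel_square \<rightarrow>\<^sub>M borel" for f
    unfolding sample_space_def compose_def
    by (intro measurable_restrict measurable_compose[OF _ observation_map_measurable[OF P s that]]
        measurable_component_singleton)
  have eq: "(\<integral>\<^sup>+ D. h D \<partial>sample_law P s n f) = (\<integral>\<^sup>+ w. h (?F f w) \<partial>?W)"
    if "f \<in> borel_square \<rightarrow>\<^sub>M borel" for f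
    unfolding sample_law_eq_distr[OF P s that] using meas[OF that] h by (simp add: nn_integral_distr)
  have "h (?F f w) = h (?F f' w)" if w: "w \<in> space ?W" for w
  proof (cases "\<exists>i<n. fst (w i) \<in> S")
    case True
    then obtain i where i: "i < n" "fst (w i) \<in> S"
      by blast
    then have "fst (?F f w i) \<in> S" "fst (?F f' w i) \<in> S"
      by (simp_all add: compose_def case_prod_beta)
    then show ?thesis
      by (simp add: h0[OF i(1)])
  next
    case False
    have w_square: "fst (w i) \<in> square" if "i < n" for i
      using w that sets_eq_imp_space_eq[OF P(2)]
      by (auto simp: space_PiM space_pair_measure PiE_iff mem_Times_iff)
    have "?F f w = ?F f' w"
      unfolding compose_def
    proof (rule restrict_ext)
      fix i assume "i \<in> {..<n}"
      then have "f (fst (w i)) = f' (fst (w i))"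
        using False w_square by (intro agree) auto
      then show "(case w i of (x, e) \<Rightarrow> (x, f x + e)) = (case w i of (x, e) \<Rightarrow> (x, f' x + e))"
        by (simp add: case_prod_beta)
    qed
    then show ?thesis
      by simp
  qed
  then show ?thesis
    unfolding eq[OF f(1)] eq[OF f(2)] by (intro nn_integral_cong)
qed

subsection \<open>Lower bound on the risk\<close>

lemma L2_norm_squared_ge_component:
  "(\<integral>\<^sup>+ y. ennreal (\<bar>h y $ k\<bar>\<^sup>2) \<partial>P) \<le> L2_norm_squared P h"
  unfolding L2_norm_squared_def
  using member_le_sum[of k UNIV "\<lambda>j. \<integral>\<^sup>+ y. ennreal (\<bar>h y $ j\<bar>\<^sup>2) \<partial>P"] by simp

lemma L2_norm_squared_ge_const:
  assumes "W \<in> sets P" "0 \<le> \<delta>" "\<And>y. y \<in> W \<Longrightarrow> \<delta> \<le> \<bar>h y $ k\<bar>"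
  shows "ennreal (\<delta>\<^sup>2) * emeasure P W \<le> L2_norm_squared P h"
proof -
  have "ennreal (\<delta>\<^sup>2) * emeasure P W = (\<integral>\<^sup>+ y. ennreal (\<delta>\<^sup>2) * indicator W y \<partial>P)"
    by (rule nn_integral_cmult_indicator[OF assms(1), symmetric])
  also have "\<dots> \<le> (\<integral>\<^sup>+ y. ennreal (\<bar>h y $ k\<bar>\<^sup>2) \<partial>P)"
  proof (rule nn_integral_mono)
    fix y
    have "ennreal (\<delta>\<^sup>2) \<le> ennreal (\<bar>h y $ k\<bar>\<^sup>2)" if "y \<in> W"
      using assms(2) assms(3)[OF that] by (intro ennreal_leI power_mono)
    then show "ennreal (\<delta>\<^sup>2) * indicator W y \<le> ennreal (\<bar>h y $ k\<bar>\<^sup>2)"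
      by (cases "y \<in> W") simp_all
  qed
  also have "\<dots> \<le> L2_norm_squared P h"
    by (rule L2_norm_squared_ge_component)
  finally show ?thesis .
qed

lemma quasi_inverse_cases:
  obtains "quasi_inverse c g y \<in> square" "g (quasi_inverse c g y) = y"
      "\<And>x. x \<in> square \<Longrightarrow> g x = y \<Longrightarrow> x = quasi_inverse c g y"
    | "quasi_inverse c g y = c"
proof (cases "\<exists>!x. x \<in> square \<and> g x = y")
  case True
  then have q: "quasi_inverse c g y = (THE x. x \<in> square \<and> g x = y)"
    by (simp add: quasi_inverse_def)
  show ?thesis
  proof (rule that(1))
    show "quasi_inverse c g y \<in> square" "g (quasi_inverse c g y) = y"
      unfolding q using theI'[OF True] by simp_all
    show "x = quasi_inverse c g y" if "x \<in> square" "g x = y" for x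
      unfolding q using the1_equality[OF True, of x] that by simp
  qed
next
  case False
  then show ?thesis
    using that(2) by (simp add: quasi_inverse_def)
qed

text \<open>The integrands of the risk may be nonmeasurable, but the integral is monotone for
  arbitrary functions, so a measurable set \<open>W\<close> on which the error is large
  suffices.\<close>

lemma inverse_risk_ge:
  assumes W: "W \<in> sets (sample_law P s n f \<Otimes>\<^sub>M P)" and "sigma_finite_measure P" and "0 \<le> \<delta>"
    and far: "\<And>D y. (D, y) \<in> W \<Longrightarrow> \<delta> \<le> \<bar>(quasi_inverse c (g D) y - inv_into square f y) $ k\<bar>"
  shows "ennreal (\<delta>\<^sup>2) * emeasure (sample_law P s n f \<Otimes>\<^sub>M P) W \<le> inverse_risk P s c n g f"
proof -
  interpret sigma_finite_measure P by fact
  have "ennreal (\<delta>\<^sup>2) * emeasure (sample_law P s n f \<Otimes>\<^sub>M P) W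
    = (\<integral>\<^sup>+ D. ennreal (\<delta>\<^sup>2) * emeasure P (Pair D -` W) \<partial>sample_law P s n f)"
    using W by (simp add: emeasure_pair_measure_alt nn_integral_cmult measurable_emeasure_Pair)
  also have "\<dots> \<le> inverse_risk P s c n g f"
    unfolding inverse_risk_def using W assms(3) far
    by (intro nn_integral_mono L2_norm_squared_ge_const[where k=k]) (auto intro: sets_Pair1)
  finally show ?thesis .
qed

text \<open>Off the event that some design point falls into \<open>S\<close>, the sample does not distinguish
  \<open>f0\<close> from \<open>f1\<close>. The decision whether a preimage under the estimator lies below or above the
  threshold \<open>m\<close> is then wrong for one of them; the value \<open>c\<close> is wrong for both.\<close>

lemma two_point_bound:
  assumes P: "prob_space P" "sets P = sets borel_square" and s: "0 < s"
    and f: "f0 \<in> borel_square \<rightarrow>\<^sub>M borel" "f1 \<in> borel_square \<rightarrow>\<^sub>M borel"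
    and g: "g \<in> estimators n"
    and S: "S \<in> sets P" and agree: "\<And>x. x \<in> square \<Longrightarrow> x \<notin> S \<Longrightarrow> f0 x = f1 x"
    and R: "R \<in> sets P" and \<delta>: "0 \<le> \<delta>"
    and c: "\<And>t. \<bar>t\<bar> \<le> 1 \<Longrightarrow> \<delta> \<le> \<bar>c $ k - t\<bar>"
    and lo: "\<And>y. y \<in> R \<Longrightarrow> inv_into square f0 y \<in> square \<and> inv_into square f0 y $ k \<le> m - \<delta>"
    and hi: "\<And>y. y \<in> R \<Longrightarrow> inv_into square f1 y \<in> square \<and> m + \<delta> \<le> inv_into square f1 y $ k"
  shows "ennreal (\<delta>\<^sup>2) * (ennreal ((1 - measure P S) ^ n) * emeasure P R)
    \<le> inverse_risk P s c n g f0 + inverse_risk P s c n g f1"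
proof -
  interpret P: prob_space P by fact
  define Q where "Q = sample_law P s n f0"
  define Q' where "Q' = sample_law P s n f1"
  have sets_Q [measurable_cong]: "sets Q = sets (sample_space n)" and sets_Q': "sets Q' = sets (sample_space n)"
    unfolding Q_def Q'_def using sets_sample_law[OF P s] f by auto
  interpret Q: prob_space Q
    unfolding Q_def by (rule prob_space_sample_law[OF P s f(1)])
  note [measurable_cong] = P(2)

  define A where "A = {z \<in> space (Q \<Otimes>\<^sub>M P). \<exists>x\<in>square. g (fst z) x = snd z \<and> x $ k \<le> m}"
  define B where "B = {w \<in> space ((Q \<Otimes>\<^sub>M P) \<Otimes>\<^sub>M borel_square).
    g (fst (fst w)) (snd w) = snd (fst w) \<and> snd w $ k \<le> m}"
  have g': "(\<lambda>z. g (fst z) (snd z)) \<in> sample_space n \<Otimes>\<^sub>M borel_square \<rightarrow>\<^sub>M borel"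
    using g by (simp add: estimators_def case_prod_beta)
  have "(\<lambda>w. (fst (fst w), snd w)) \<in> (Q \<Otimes>\<^sub>M P) \<Otimes>\<^sub>M borel_square \<rightarrow>\<^sub>M sample_space n \<Otimes>\<^sub>M borel_square"
    by measurable
  from measurable_compose[OF this g']
  have "(\<lambda>w. g (fst (fst w)) (snd w)) \<in> (Q \<Otimes>\<^sub>M P) \<Otimes>\<^sub>M borel_square \<rightarrow>\<^sub>M borel"
    by simp
  moreover have "(\<lambda>w. snd (fst w)) \<in> (Q \<Otimes>\<^sub>M P) \<Otimes>\<^sub>M borel_square \<rightarrow>\<^sub>M borel"
  proof -
    have "(\<lambda>w. snd (fst w)) \<in> (Q \<Otimes>\<^sub>M P) \<Otimes>\<^sub>M borel_square \<rightarrow>\<^sub>M borel_square"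
      by measurable
    from measurable_compose[OF this measurable_borel_square_borel] show ?thesis .
  qed
  moreover have "(\<lambda>w. snd w $ k) \<in> (Q \<Otimes>\<^sub>M P) \<Otimes>\<^sub>M borel_square \<rightarrow>\<^sub>M borel"
  proof -
    have "(\<lambda>x. x $ k) \<in> borel_square \<rightarrow>\<^sub>M borel"
      by (intro borel_measurable_continuous_on_restrict continuous_intros)
    from measurable_compose[OF measurable_snd this] show ?thesis .
  qed
  ultimately have "B \<in> sets ((Q \<Otimes>\<^sub>M P) \<Otimes>\<^sub>M borel_square)"
    unfolding B_def by measurable
  moreover have "fst ` B = A"
    unfolding A_def B_def by (force simp: space_pair_measure)
  moreover have "finite_measure (Q \<Otimes>\<^sub>M P)"
    by (intro prob_space.finite_measure prob_space_pair P.prob_space_axioms Q.prob_space_axioms)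
  ultimately obtain N T where NT: "N \<in> sets (Q \<Otimes>\<^sub>M P)" "T \<in> sets (Q \<Otimes>\<^sub>M P)" "N \<subseteq> A" "A \<subseteq> T"
      "emeasure (Q \<Otimes>\<^sub>M P) (T - N) = 0"
    using measurable_projection_sandwich[of "Q \<Otimes>\<^sub>M P" B borel_square] sets_borel_square_subset by blast

  define E where "E = {D \<in> space (sample_space n). \<forall>i<n. fst (D i) \<notin> S}"
  have E_emeasure: "emeasure Q E = ennreal ((1 - measure P S) ^ n)"
    unfolding Q_def E_def by (rule emeasure_sample_law_avoid[OF P s f(1) S])
  have E: "E \<in> sets Q"
    unfolding sets_Q E_def using S P(2) by (intro avoid_in_sets) simp
  \<comment> \<open>Points of \<open>W0\<close> are surely outside \<open>A\<close> and points of
    \<open>W1\<close> surely inside, while both sets are measurable.\<close>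
  define W0 where "W0 = E \<times> R - T"
  define W1 where "W1 = E \<times> R \<inter> N"
  have W: "W0 \<in> sets (Q \<Otimes>\<^sub>M P)" "W1 \<in> sets (Q \<Otimes>\<^sub>M P)"
    unfolding W0_def W1_def using E R NT by auto
  have sets_QP: "sets (Q' \<Otimes>\<^sub>M P) = sets (Q \<Otimes>\<^sub>M P)" "sets (sample_space n \<Otimes>\<^sub>M P) = sets (Q \<Otimes>\<^sub>M P)"
    using sets_Q sets_Q' by (auto intro: sets_pair_measure_cong)
  have space_QP: "(D, y) \<in> space (Q \<Otimes>\<^sub>M P)" if "D \<in> E" "y \<in> R" for D y
    using that sets.sets_into_space[OF E] sets.sets_into_space[OF R] by (auto simp: space_pair_measure)

  have risk0: "ennreal (\<delta>\<^sup>2) * emeasure (Q \<Otimes>\<^sub>M P) W0 \<le> inverse_risk P s c n g f0"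
    unfolding Q_def
  proof (rule inverse_risk_ge[where k=k])
    fix D y assume "(D, y) \<in> W0"
    then have y: "y \<in> R" and "(D, y) \<notin> A" "D \<in> E"
      using NT(4) by (auto simp: W0_def)
    then have notA: "m < x $ k" if "x \<in> square" "g D x = y" for x
      using that space_QP[of D y] by (auto simp: A_def not_le)
    show "\<delta> \<le> \<bar>(quasi_inverse c (g D) y - inv_into square f0 y) $ k\<bar>"
    proof (rule quasi_inverse_cases[of c "g D" y])
      assume "quasi_inverse c (g D) y \<in> square" "g D (quasi_inverse c (g D) y) = y"
      then show ?thesis
        using notA lo[OF y] by fastforce
    next
      assume "quasi_inverse c (g D) y = c"
      then show ?thesis
        using c lo[OF y] by (simp add: square_iff)
    qed
  qed (use W(1) P.sigma_finite_measure_axioms \<delta> in \<open>simp_all add: Q_def\<close>)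

  have "ennreal (\<delta>\<^sup>2) * emeasure (Q' \<Otimes>\<^sub>M P) W1 \<le> inverse_risk P s c n g f1"
    unfolding Q'_def
  proof (rule inverse_risk_ge[where k=k])
    fix D y assume "(D, y) \<in> W1"
    then have y: "y \<in> R" and "(D, y) \<in> A"
      using NT(3) by (auto simp: W1_def)
    from \<open>(D, y) \<in> A\<close> have "\<exists>x\<in>square. g D x = y \<and> x $ k \<le> m"
      by (simp add: A_def)
    then obtain x where x: "x \<in> square" "g D x = y" "x $ k \<le> m"
      by blast
    show "\<delta> \<le> \<bar>(quasi_inverse c (g D) y - inv_into square f1 y) $ k\<bar>"
    proof (rule quasi_inverse_cases[of c "g D" y])
      assume unique: "\<And>x. x \<in> square \<Longrightarrow> g D x = y \<Longrightarrow> x = quasi_inverse c (g D) y"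
      show ?thesis
        using x(3) hi[OF y] \<delta> unfolding unique[OF x(1,2), symmetric] by (simp add: abs_if)
    next
      assume "quasi_inverse c (g D) y = c"
      then show ?thesis
        using c hi[OF y] by (simp add: square_iff)
    qed
  qed (use W(2) sets_QP(1) P.sigma_finite_measure_axioms \<delta> in \<open>simp_all add: Q'_def\<close>)
  \<comment> \<open>The null set \<open>T - N\<close> refers to the law under \<open>f0\<close>. The
    sections of \<open>W1\<close> are empty off the avoidance event \<open>E\<close>, so its measure
    can be moved to that law.\<close>
  also have "emeasure (Q' \<Otimes>\<^sub>M P) W1 = emeasure (Q \<Otimes>\<^sub>M P) W1"
  proof -
    have "(\<integral>\<^sup>+ D. emeasure P (Pair D -` W1) \<partial>Q) = (\<integral>\<^sup>+ D. emeasure P (Pair D -` W1) \<partial>Q')"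
      unfolding Q_def Q'_def
    proof (rule sample_law_agree[OF P s f agree])
      show "(\<lambda>D. emeasure P (Pair D -` W1)) \<in> borel_measurable (sample_space n)"
        using W(2) sets_QP(2) by (intro P.measurable_emeasure_Pair) simp
      fix D :: "nat \<Rightarrow> (real^2) \<times> (real^2)" and i assume "i < n" "fst (D i) \<in> S"
      then have "Pair D -` W1 = {}"
        by (auto simp: W1_def E_def)
      then show "emeasure P (Pair D -` W1) = 0"
        by simp
    qed
    then show ?thesis
      using W(2) sets_QP(1) by (simp add: P.emeasure_pair_measure_alt)
  qed
  finally have risk1: "ennreal (\<delta>\<^sup>2) * emeasure (Q \<Otimes>\<^sub>M P) W1 \<le> inverse_risk P s c n g f1" .

  have "emeasure Q E * emeasure P R = emeasure (Q \<Otimes>\<^sub>M P) (E \<times> R)"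
    using E R by (simp add: P.emeasure_pair_measure_Times)
  also have "\<dots> \<le> emeasure (Q \<Otimes>\<^sub>M P) ((W0 \<union> W1) \<union> (T - N))"
    using W NT by (intro emeasure_mono) (auto simp: W0_def W1_def)
  also have "\<dots> = emeasure (Q \<Otimes>\<^sub>M P) (W0 \<union> W1)"
    using W NT by (intro emeasure_Un_null_set) (auto simp: null_sets_def)
  also have "\<dots> \<le> emeasure (Q \<Otimes>\<^sub>M P) W0 + emeasure (Q \<Otimes>\<^sub>M P) W1"
    using W by (rule emeasure_subadditive)
  finally have "ennreal (\<delta>\<^sup>2) * (emeasure Q E * emeasure P R)
    \<le> ennreal (\<delta>\<^sup>2) * (emeasure (Q \<Otimes>\<^sub>M P) W0 + emeasure (Q \<Otimes>\<^sub>M P) W1)"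
    by (rule mult_left_mono) simp
  also have "\<dots> \<le> inverse_risk P s c n g f0 + inverse_risk P s c n g f1"
    using add_mono[OF risk0 risk1] by (simp add: distrib_left)
  finally show ?thesis
    by (simp add: E_emeasure)
qed

section \<open>Design mass of sets and choice of the constants\<close>

lemma sets_design_law: "sets (design_law p) = sets borel_square"
  by (simp add: design_law_def sets_restrict_space)

lemma square_Collect_closed:
  "closed T \<Longrightarrow> square \<inter> T \<in> sets borel_square"
  by (auto simp: sets_restrict_space)

lemma emeasure_design_law_pos:
  assumes p: "p \<in> borel_measurable borel_square" "\<forall>x\<in>square. 0 < p x"
    and R: "R \<in> sets borel_square" and ball: "ball z r \<subseteq> R" "0 < r"
  shows "0 < emeasure (design_law p) R"
proof (rule ccontr)
  let ?M = "restrict_space lborel square"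
  have sets_M: "sets ?M = sets borel_square"
    by (simp add: sets_restrict_space)
  have p': "(\<lambda>x. ennreal (p x)) \<in> borel_measurable ?M"
    using p(1) by (subst measurable_cong_sets[OF sets_M refl]) measurable
  assume "\<not> 0 < emeasure (design_law p) R"
  then have "R \<in> null_sets (density ?M (\<lambda>x. ennreal (p x)))"
    using R sets_M by (simp add: null_sets_def design_law_def)
  then have "AE x in ?M. x \<in> R \<longrightarrow> ennreal (p x) = 0"
    using null_sets_density_iff[OF p'] by blast
  moreover have "AE x in ?M. x \<in> square"
    by (rule AE_I2) (simp add: space_restrict_space)
  ultimately have "AE x in ?M. x \<notin> R"
  proof eventually_elim
    case (elim x)
    then show ?case
      using p(2) by (auto simp: ennreal_eq_0_iff not_le[symmetric])
  qed
  then have "R \<in> null_sets ?M"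
    using R sets_M by (intro AE_iff_null_sets[THEN iffD2]) auto
  then have "emeasure lborel R = 0"
    using R closed_square by (auto simp: null_sets_def sets_restrict_space emeasure_restrict_space)
  moreover have "R \<in> sets lborel"
    using R sets_borel_square_subset by auto
  ultimately have "emeasure lborel (ball z r) = 0"
    using emeasure_mono[OF ball(1)] by (metis le_zero_eq)
  then show False
    using content_ball_pos[OF ball(2), of z] by (simp add: measure_def)
qed

lemma emeasure_design_law_strip:
  assumes p: "p \<in> borel_measurable borel_square" "\<forall>x\<in>square. p x \<le> B" and d: "0 \<le> d" and B: "0 \<le> B"
  shows "emeasure (design_law p) (square \<inter> {x. \<bar>x $ (k + 1)\<bar> \<le> d}) \<le> ennreal (4 * B * d)"
proof -
  let ?M = "restrict_space lborel square"
  let ?S = "square \<inter> {x. \<bar>x $ (k + 1)\<bar> \<le> d}"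
  have sets_M: "sets ?M = sets borel_square"
    by (simp add: sets_restrict_space)
  have p': "(\<lambda>x. ennreal (p x)) \<in> borel_measurable ?M"
    using p(1) by (subst measurable_cong_sets[OF sets_M refl]) measurable
  have S: "?S \<in> sets ?M"
    unfolding sets_M by (intro square_Collect_closed closed_Collect_le continuous_intros)
  \<comment> \<open>The strip inside the square fits in a box with half sides 1 and
    \<open>d\<close>, of area \<open>4 * d\<close>.\<close>
  define u :: "real^2" where "u = (\<chi> i. if i = k then 1 else d)"
  have UNIV: "(UNIV :: 2 set) = {k, k + 1}"
    using index_2(1) by blast
  have "emeasure lborel ?S \<le> emeasure lborel (cbox (- u) u)"
  proof (rule emeasure_mono)
    show "?S \<subseteq> cbox (- u) u"
    proof
      fix x assume x: "x \<in> ?S"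
      have "\<bar>x $ i\<bar> \<le> u $ i" for i
        using x index_2(1)[of i k] by (auto simp: u_def square_iff)
      then show "x \<in> cbox (- u) u"
        by (simp add: mem_box_cart abs_le_iff minus_le_iff)
    qed
  qed simp
  also have "\<dots> = ennreal (measure lborel (cbox (- u) u))"
    using emeasure_lborel_cbox_finite[of "- u" u] by (intro emeasure_eq_ennreal_measure) simp
  also have "measure lborel (cbox (- u) u) = 4 * d"
  proof -
    have "cbox (- u) u \<noteq> {}"
      using d by (auto simp: interval_ne_empty_cart u_def)
    then have "measure lborel (cbox (- u) u) = (\<Prod>i\<in>UNIV. u $ i - (- u) $ i)"
      by (rule content_cbox_cart)
    also have "\<dots> = 4 * d"
      unfolding UNIV using index_2(2)[of k] by (subst prod.insert) (auto simp: u_def)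
    finally show ?thesis .
  qed
  finally have lborel_S: "emeasure lborel ?S \<le> ennreal (4 * d)" .
  have "emeasure (design_law p) ?S = (\<integral>\<^sup>+ x. ennreal (p x) * indicator ?S x \<partial>?M)"
    unfolding design_law_def by (rule emeasure_density[OF p' S])
  also have "\<dots> \<le> (\<integral>\<^sup>+ x. ennreal B * indicator ?S x \<partial>?M)"
    using p(2) by (intro nn_integral_mono mult_right_mono ennreal_leI) (auto simp: space_restrict_space)
  also have "\<dots> = ennreal B * emeasure ?M ?S"
    by (rule nn_integral_cmult_indicator[OF S])
  also have "emeasure ?M ?S = emeasure lborel ?S"
    using closed_square by (intro emeasure_restrict_space) auto
  also have "ennreal B * \<dots> \<le> ennreal B * ennreal (4 * d)"
    by (intro mult_left_mono lborel_S) simp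
  also have "\<dots> = ennreal (4 * B * d)"
    using B d by (simp add: ennreal_mult[symmetric] ac_simps)
  finally show ?thesis .
qed

lemma ennreal_half_le:
  assumes "ennreal (2 * a) \<le> x + x" "0 \<le> a"
  shows "ennreal a \<le> x"
proof (cases x)
  case (real r)
  then show ?thesis
    using assms by (simp flip: ennreal_plus)
qed simp

lemma constant_minimax_bound:
  fixes p :: "real^2 \<Rightarrow> real" and \<sigma> :: real and c :: "real^2"
  assumes p: "p \<in> borel_measurable borel_square"
    and pos: "\<forall>x\<in>square. 0 < p x"
    and bounded: "\<exists>B. \<forall>x\<in>square. p x \<le> B"
    and prob: "prob_space (design_law p)"
    and \<sigma>: "\<sigma> > 0"
    and c: "c \<notin> square"
  shows "\<exists>C>0. \<forall>n. \<forall>g\<in>estimators n. ennreal C \<le> (SUP f\<in>bilipschitz_bijections. inverse_risk (design_law p) \<sigma> c n g f)"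
proof -
  let ?P = "design_law p"
  interpret P: prob_space ?P by fact
  obtain k where k: "1 < \<bar>c $ k\<bar>"
    using c by (auto simp: square_iff not_le)
  \<comment> \<open>The bound 1/32 separates the values 1/16 and 11/64 met on \<open>R\<close> from
    the threshold 1/8; the second term is the distance of \<open>c $ k\<close> from the
    interval.\<close>
  define \<delta> where "\<delta> = min (1/32) (\<bar>c $ k\<bar> - 1)"
  have \<delta>: "\<delta> \<le> 1/32" "\<delta> \<le> \<bar>c $ k\<bar> - 1"
    unfolding \<delta>_def by (rule min.cobounded1, rule min.cobounded2)
  have \<delta>_pos: "0 < \<delta>"
    using k by (simp add: \<delta>_def)
  obtain B0 where "\<forall>x\<in>square. p x \<le> B0"
    using bounded by blast
  then obtain B where B: "1 \<le> B" "\<forall>x\<in>square. p x \<le> B"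
    by (metis max.cobounded1 max.coboundedI2)
  \<comment> \<open>For coordinate \<open>k + 1\<close> up to 1/4 the tent of \<open>shear\<close>
    is at least 1/2; for coordinate \<open>k\<close> up to 1/16 the factor
    \<open>1 - \<bar>t\<bar>\<close> is at least 15/16.\<close>
  define R where "R = square \<inter> {y. \<bar>y $ (k + 1)\<bar> \<le> 1/4 \<and> \<bar>y $ k\<bar> \<le> 1/16}"
  have R_sets: "R \<in> sets borel_square"
    unfolding R_def by (intro square_Collect_closed closed_Collect_conj closed_Collect_le continuous_intros)
  have "ball 0 (1/16) \<subseteq> R"
  proof
    fix y :: "real^2" assume "y \<in> ball 0 (1/16)"
    then have y: "\<bar>y $ i\<bar> \<le> 1/16" for i
      using component_le_norm_cart[of y i] by simp
    have "\<bar>y $ i\<bar> \<le> 1" "\<bar>y $ i\<bar> \<le> 1/4" for i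
      by (rule order_trans[OF y], simp)+
    with y show "y \<in> R"
      by (simp add: R_def square_iff)
  qed
  then have R_pos: "0 < emeasure ?P R"
    using R_sets by (intro emeasure_design_law_pos[OF p pos]) auto
  \<comment> \<open>One factor 1/2 is the probability of avoiding the strip, the other passes from
    the sum of two risks to their supremum.\<close>
  define C where "C = \<delta>\<^sup>2 * measure ?P R / 4"
  have "0 < C"
    using R_pos \<delta>_pos by (simp add: C_def P.emeasure_eq_measure)
  moreover have "ennreal C \<le> (SUP f\<in>bilipschitz_bijections. inverse_risk ?P \<sigma> c n g f)"
    (is "_ \<le> ?X") if g: "g \<in> estimators n" for n g
  proof -
    \<comment> \<open>Makes the mass of the strip at most \<open>1 / (2 * (real n + 1))\<close>, so
      that Bernoulli's inequality yields 1/2. Adding 1 to \<open>n\<close> covers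
      \<open>n = 0\<close>, and \<open>B \<ge> 1\<close> ensures \<open>d \<le> 1/2\<close>.\<close>
    define d where "d = 1 / (8 * B * (real n + 1))"
    have "1 \<le> B * (real n + 1)"
      using B(1) mult_mono[of 1 B 1 "real n + 1"] by simp
    then have d: "0 < d" "d \<le> 1/2"
      using B(1) by (auto simp: d_def divide_simps)
    define S where "S = square \<inter> {x. \<bar>x $ (k + 1)\<bar> \<le> d}"
    define f where "f a = inv_into square (twist k d a)" for a
    have twist_class: "twist k d a \<in> bilipschitz_bijections" if "a \<in> {0, 1}" for a
      using that d by (intro twist_in_class) auto
    have f_class: "f 0 \<in> bilipschitz_bijections" "f 1 \<in> bilipschitz_bijections"
      unfolding f_def by (auto intro!: inv_into_in_class twist_class)
    have inv_f: "inv_into square (f a) y = twist k d a y" "twist k d a y \<in> square"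
      if "a \<in> {0, 1}" "y \<in> square" for a y
    proof -
      have "bij_betw (twist k d a) square square"
        using twist_class[OF that(1)] by (simp add: bilipschitz_bijections_def)
      then show "inv_into square (f a) y = twist k d a y" "twist k d a y \<in> square"
        unfolding f_def using that(2) by (auto intro: inv_into_inv_into_eq simp: bij_betw_apply)
    qed
    have "S \<in> sets borel_square"
      unfolding S_def by (intro square_Collect_closed closed_Collect_le continuous_intros)
    have "ennreal (measure ?P S) \<le> ennreal (4 * B * d)"
      using emeasure_design_law_strip[OF p B(2), of d k] d B(1)
      by (simp add: S_def P.emeasure_eq_measure)
    then have "measure ?P S \<le> 4 * B * d"
      using B(1) d(1) by (simp add: ennreal_le_iff)
    also have "4 * B * d = 1 / (2 * (real n + 1))"
      using B(1) by (simp add: d_def divide_simps)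
    finally have q: "measure ?P S \<le> 1 / (2 * (real n + 1))" .
    have half: "1/2 \<le> (1 - measure ?P S) ^ n"
    proof -
      have "real n * measure ?P S \<le> real n * (1 / (2 * (real n + 1)))"
        using q by (intro mult_left_mono) auto
      also have "\<dots> \<le> 1/2"
        by (simp add: divide_simps)
      finally have "1/2 \<le> 1 + real n * (- measure ?P S)"
        by simp
      also have "\<dots> \<le> (1 + (- measure ?P S)) ^ n"
        by (rule Bernoulli_inequality) simp
      finally show ?thesis
        by simp
    qed
    have two: "ennreal (\<delta>\<^sup>2) * (ennreal ((1 - measure ?P S) ^ n) * emeasure ?P R)
        \<le> inverse_risk ?P \<sigma> c n g (f 0) + inverse_risk ?P \<sigma> c n g (f 1)"
    proof (rule two_point_bound[OF prob sets_design_law \<sigma> _ _ g, where k=k and m="1/8" and S=S])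
      show "f 0 \<in> borel_measurable borel_square" "f 1 \<in> borel_measurable borel_square"
        using f_class by (auto intro: bilipschitz_bijections_measurable)
      show "S \<in> sets ?P" "R \<in> sets ?P"
        using R_sets \<open>S \<in> sets borel_square\<close> by (simp_all add: sets_design_law)
      show "f 0 x = f 1 x" if "x \<in> square" "x \<notin> S" for x
        using that inv_twist_agree[OF d, of x k] by (simp add: f_def S_def not_le)
      show "0 \<le> \<delta>"
        using \<delta>_pos by simp
      show "\<delta> \<le> \<bar>c $ k - t\<bar>" if "\<bar>t\<bar> \<le> 1" for t
        using \<delta>(2) that by linarith
      fix y assume "y \<in> R"
      then have y: "y \<in> square" "\<bar>y $ (k + 1)\<bar> \<le> 1/4" "\<bar>y $ k\<bar> \<le> 1/16"
        by (auto simp: R_def)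
      have "y $ k \<le> 1/16" "- (1/16) \<le> y $ k"
        using y(3) by (auto simp: abs_le_iff)
      then show "inv_into square (f 0) y \<in> square \<and> inv_into square (f 0) y $ k \<le> 1/8 - \<delta>"
        using inv_f[of 0 y] y(1) \<delta>(1) by (simp add: shear_def)
      \<comment> \<open>Half of this product is 15/64, and 15/64 - 1/16 = 11/64 exceeds 1/8 +
        1/32.\<close>
      have "(1/2) * (15/16) \<le> max 0 (1 - 2 * \<bar>y $ (k + 1)\<bar>) * (1 - \<bar>y $ k\<bar>)"
        using y by (intro mult_mono) auto
      then show "inv_into square (f 1) y \<in> square \<and> 1/8 + \<delta> \<le> inv_into square (f 1) y $ k"
        using inv_f[of 1 y] y(1) \<delta>(1) \<open>- (1/16) \<le> y $ k\<close> by (simp add: shear_def)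
    qed
    have "ennreal (2 * C) = ennreal (\<delta>\<^sup>2) * (ennreal (1/2) * emeasure ?P R)"
    proof -
      have "2 * C = \<delta>\<^sup>2 * (1/2 * measure ?P R)"
        by (simp add: C_def)
      then show ?thesis
        by (simp only: P.emeasure_eq_measure ennreal_mult' zero_le_power2 zero_le_divide_1_iff zero_le_numeral)
    qed
    also have "\<dots> \<le> ennreal (\<delta>\<^sup>2) * (ennreal ((1 - measure ?P S) ^ n) * emeasure ?P R)"
      using half by (intro mult_left_mono mult_right_mono ennreal_leI) auto
    also note two
    also have "inverse_risk ?P \<sigma> c n g (f 0) + inverse_risk ?P \<sigma> c n g (f 1) \<le> ?X + ?X"
      using f_class by (intro add_mono SUP_upper)
    finally show "ennreal C \<le> ?X"
      by (rule ennreal_half_le) (use \<open>0 < C\<close> in simp)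
  qed
  ultimately show ?thesis
    by blast
qed

theorem theorem6:
  fixes p :: "real^2 \<Rightarrow> real" and \<sigma> :: real and c :: "real^2"
  assumes "p \<in> borel_measurable borel_square"
    and "\<forall>x\<in>square. 0 < p x"
    and "\<exists>B. \<forall>x\<in>square. p x \<le> B"
    and "prob_space (design_law p)"
    and "\<sigma> > 0"
    and "c \<notin> square"
  shows "\<exists>C::real>0. \<forall>n\<ge>(1::nat).
    (INF g\<in>estimators n. SUP f\<in>bilipschitz_bijections.
        inverse_risk (design_law p) \<sigma> c n g f)
      \<ge> ennreal (C * real n powr (- 2 / (2 + 2)))"
proof -
  obtain C where C: "0 < C" "\<And>n g. g \<in> estimators n \<Longrightarrow>
      ennreal C \<le> (SUP f\<in>bilipschitz_bijections. inverse_risk (design_law p) \<sigma> c n g f)"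
    using constant_minimax_bound[OF assms] by blast
  have "ennreal (C * real n powr (- 2 / (2 + 2)))
      \<le> (INF g\<in>estimators n. SUP f\<in>bilipschitz_bijections. inverse_risk (design_law p) \<sigma> c n g f)"
    if "1 \<le> n" for n :: nat
  proof (rule INF_greatest)
    fix g assume g: "g \<in> estimators n"
    \<comment> \<open>The rate enters only here: for \<open>n \<ge> 1\<close> it is at most 1, so
      the constant bound implies it.\<close>
    have "real n powr (- 2 / (2 + 2)) \<le> real n powr 0"
      using that by (intro powr_mono) auto
    then have "C * real n powr (- 2 / (2 + 2)) \<le> C * 1"
      using C(1) that by (intro mult_left_mono) auto
    then have "ennreal (C * real n powr (- 2 / (2 + 2))) \<le> ennreal C"
      by (intro ennreal_leI) simp
    also note C(2)[OF g]
    finally show "ennreal (C * real n powr (- 2 / (2 + 2)))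
        \<le> (SUP f\<in>bilipschitz_bijections. inverse_risk (design_law p) \<sigma> c n g f)" .
  qed
  with C(1) show ?thesis
    by blast
qed

end
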